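(* For every integer $k>1$, the space $\mathbb{Y}(\mathcal{I}^k)$ is a nodec regular space with analytic topology which is not selectively separable (not $SS$) and is not a $q^+$-space.
   Context: $\mathbb{N}=\{0,1,2,\dots\}$; $2^{\mathbb{N}}$ is the Cantor space, and subsets of $\mathbb{N}$ are identified with their characteristic functions in $2^{\mathbb{N}}$. An ideal on a set $Z$ is a family of subsets of $Z$ containing all finite subsets and closed under taking subsets and finite unions (the whole power set is allowed). For a finite binary sequence $s\in 2^{<\omega}$ let $[s]=\{\alpha\in 2^{\mathbb{N}}:\alpha(i)=s(i)\text{ for all }i<|s|\}$. For nonempty $\mathcal{A}\subseteq 2^{\mathbb{N}}$, $\rho_{\mathcal{A}}$ is the topology on $2^{2^{\mathbb{N}}\times\mathbb{N}}$ generated by the subbasic sets $(\alpha,p)^+=\{\theta:\theta(\alpha,p)=1\}$ and $(\alpha,p)^-=\{\theta:\theta(\alpha,p)=0\}$ with $\alpha\in\mathcal{A}$, $p\in\mathbb{N}$. Let $\mathbb{X}$ be the countable set of all finite unions of sets $[s]\times\{n\}$ ($s\in 2^{<\omega}$, $n\in\mathbb{N}$), including $\emptyset$, viewed (via characteristic functions) as a subset of $2^{2^{\mathbb{N}}\times\mathbb{N}}$. Fix a one-to-one enumeration $\{\varphi_n:n\in\mathbb{N}\}$ of $\mathbb{X}$ with $\varphi_0=\emptyset$. Define $\psi_n:2^{\mathbb{N}}\times\mathbb{N}\to\{0,1\}$ by $\psi_n(\alpha,m)=\varphi_n(\alpha,m)$ if $\alpha(n)=0$ and $\psi_n(\alpha,m)=1$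 if $\alpha(n)=1$; let $\mathbb{Y}=\{\psi_n:n\in\mathbb{N}\}$. $\mathbb{X}(\mathcal{I})=(\mathbb{X},\rho_{\mathcal{I}})$ and $\mathbb{Y}(\mathcal{I})=(\mathbb{Y},\rho_{\mathcal{I}})$ (subspace topologies). For nonempty $\mathcal{I}\subseteq 2^{\mathbb{N}}$ let $\mathcal{I}^{\star}=\{F\subseteq\mathbb{N}:\{\varphi_n:n\in F\}\text{ is nowhere dense in }\mathbb{X}(\mathcal{I})\}$. Define $\mathcal{I}^0=2^{\mathbb{N}}$ and $\mathcal{I}^k=(\mathcal{I}^{k-1})^{\star}$ for $k>0$. A space is nodec if every nowhere dense set is closed. A topology on a countable set $Z$ is analytic if it is an analytic subset of $2^Z$. A space $Z$ is selectively separable ($SS$) if for every sequence $(D_n)_n$ of dense subsets of $Z$ there are finite sets $F_n\subseteq D_n$ with $\bigcup_nF_n$ dense in $Z$. For a point $x$ of a space $Z$, $\mathcal{I}_x=\{A\subseteq Z:x\notin\overline{A\setminus\{x\}}\}$. An ideal $\mathcal{J}$ is $q^+$ if for every $A\notin\mathcal{J}$ and every partition $(F_n)_n$ of $A$ into finite sets there is $S\subseteq A$, $S\notin\mathcal{J}$, such that $S\cap F_n$ has at most one element for each $n$. A space is a $q^+$-space if $\mathcal{I}_x$ is $q^+$ for every point $x$. *)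

theory Defs
  imports "HOL-Analysis.Analysis"
begin

section \<open>Notions for arbitrary topological spaces\<close>

definition dense_in :: "'a topology \<Rightarrow> 'a set \<Rightarrow> bool" where
  "dense_in Z D \<longleftrightarrow> D \<subseteq> topspace Z \<and> Z closure_of D = topspace Z"

definition nowhere_dense_in :: "'a topology \<Rightarrow> 'a set \<Rightarrow> bool" where
  "nowhere_dense_in Z A \<longleftrightarrow> A \<subseteq> topspace Z \<and> Z interior_of (Z closure_of A) = {}"

definition nodec_space :: "'a topology \<Rightarrow> bool" where
  "nodec_space Z \<longleftrightarrow> (\<forall>A. nowhere_dense_in Z A \<longrightarrow> closedin Z A)"

definition selectively_separable :: "'a topology \<Rightarrow> bool" where
  "selectively_separable Z \<longleftrightarrow>
    (\<forall>D :: nat \<Rightarrow> 'a set. (\<forall>n. dense_in Z (D n)) \<longrightarrow>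
      (\<exists>F. (\<forall>n. finite (F n) \<and> F n \<subseteq> D n) \<and> dense_in Z (\<Union>n. F n)))"

text \<open>Analytic subsets are only meant to be formed in Polish spaces \<open>P\<close>; there they are the
  empty set and the continuous images of the Baire space, which is \<^typ>\<open>nat \<Rightarrow> nat\<close> with the
  product topology.\<close>

definition analytic_subset :: "'a topology \<Rightarrow> 'a set \<Rightarrow> bool" where
  "analytic_subset P A \<longleftrightarrow> A = {} \<or>
    (\<exists>f. continuous_map (euclidean :: (nat \<Rightarrow> nat) topology) P f \<and> range f = A)"

definition powerset_space :: "'a set \<Rightarrow> ('a \<Rightarrow> bool) topology" where
  "powerset_space Z = product_topology (\<lambda>_. discrete_topology UNIV) Z"

text \<open>Points of \<^const>\<open>product_topology\<close> are extensional functions, hence the restriction of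
  the characteristic functions to the underlying set.\<close>

definition analytic_topology :: "'a topology \<Rightarrow> bool" where
  "analytic_topology Z \<longleftrightarrow> countable (topspace Z) \<and>
    analytic_subset (powerset_space (topspace Z))
      {restrict (\<lambda>z. z \<in> U) (topspace Z) |U. openin Z U}"

definition point_ideal :: "'a topology \<Rightarrow> 'a \<Rightarrow> 'a set set" where
  "point_ideal Z x = {A. A \<subseteq> topspace Z \<and> x \<notin> Z closure_of (A - {x})}"

text \<open>\<open>J\<close> is a family of subsets of \<open>Z\<close>. The sets \<open>F n\<close> of a partition may be empty; since
  empty pieces can be dropped, this only matters for finite \<open>A\<close>, and finite sets belong to
  every ideal.\<close>

definition q_plus :: "'a set \<Rightarrow> 'a set set \<Rightarrow> bool" where
  "q_plus Z J \<longleftrightarrow>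
    (\<forall>A F. A \<subseteq> Z \<and> A \<notin> J \<and> (\<forall>n::nat. finite (F n)) \<and> disjoint_family F \<and> (\<Union>n. F n) = A \<longrightarrow>
      (\<exists>S. S \<subseteq> A \<and> S \<notin> J \<and> (\<forall>n. card (S \<inter> F n) \<le> 1)))"

definition q_plus_space :: "'a topology \<Rightarrow> bool" where
  "q_plus_space Z \<longleftrightarrow> (\<forall>x\<in>topspace Z. q_plus (topspace Z) (point_ideal Z x))"

section \<open>The spaces \<open>\<X>(\<I>)\<close> and \<open>\<Y>(\<I>)\<close>\<close>

type_synonym cantor = "nat \<Rightarrow> bool"

text \<open>The elements of $2^{2^{\mathbb{N}}\times\mathbb{N}}$.\<close>

type_synonym point = "cantor \<times> nat \<Rightarrow> bool"

definition rho :: "cantor set \<Rightarrow> point topology" where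
  "rho \<A> = topology_generated_by
     ({{\<theta>. \<theta> (\<alpha>, p)} |\<alpha> p. \<alpha> \<in> \<A>} \<union> {{\<theta>. \<not> \<theta> (\<alpha>, p)} |\<alpha> p. \<alpha> \<in> \<A>})"

definition cone :: "bool list \<Rightarrow> cantor set" where
  "cone s = {\<alpha>. \<forall>i<length s. \<alpha> i = s ! i}"

definition XX :: "point set" where
  "XX = {(\<lambda>z. z \<in> \<Union>B) |B. finite B \<and> B \<subseteq> {cone s \<times> {n} |s n. True}}"

definition psi :: "(nat \<Rightarrow> point) \<Rightarrow> nat \<Rightarrow> point" where
  "psi \<phi> n = (\<lambda>(\<alpha>, m). if \<alpha> n then True else \<phi> n (\<alpha>, m))"

definition X_space :: "cantor set \<Rightarrow> point topology" where
  "X_space \<I> = subtopology (rho \<I>) XX"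

definition Y_space :: "(nat \<Rightarrow> point) \<Rightarrow> cantor set \<Rightarrow> point topology" where
  "Y_space \<phi> \<I> = subtopology (rho \<I>) (range (psi \<phi>))"

text \<open>A subset \<open>F\<close> of the natural numbers is represented by its characteristic function.\<close>

definition star :: "(nat \<Rightarrow> point) \<Rightarrow> cantor set \<Rightarrow> cantor set" where
  "star \<phi> \<I> = {F. nowhere_dense_in (X_space \<I>) (\<phi> ` {n. F n})}"

primrec iter_star :: "(nat \<Rightarrow> point) \<Rightarrow> nat \<Rightarrow> cantor set" where
  "iter_star \<phi> 0 = UNIV"
| "iter_star \<phi> (Suc k) = star \<phi> (iter_star \<phi> k)"

end

theory Submission
  imports Defs
begin

text \<open>Write \<open>J\<close> for $\mathcal{I}^{k-1}$ and \<open>I\<close> for $\mathcal{I}^k = J^\star$; the iterates decrease,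
  so \<open>I \<subseteq> J\<close>. If $\{\psi_n : n \in F\}$ is nowhere dense in $\mathbb{Y}(I)$, then
  $\{\varphi_n : n \in F\}$ is nowhere dense in $\mathbb{X}(J)$: finitely many coordinates from \<open>I\<close>
  disturb only a set of indices that is itself nowhere dense in $\mathbb{X}(J)$. So \<open>F \<in> I\<close>, and the
  coordinate \<open>F\<close> shows that $\{\psi_n : n \in F\}$ is closed.

  For the negative results fix \<open>\<beta> \<in> J\<close>. The sets of \<open>x\<close> whose least \<open>m\<close> with \<open>x(\<beta>, m) = 1\<close> is \<open>n\<close>
  are disjoint and open with dense union; let \<open>P\<^sub>n\<close> be their index sets. Every union of finite sets
  \<open>F\<^sub>n \<subseteq> P\<^sub>n\<close> belongs to \<open>I\<close>, whereas for \<open>k > 1\<close> no \<open>P\<^sub>n\<close> belongs to \<open>J\<close>. Hence the sets \<open>D\<^sub>n\<close> of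
  points containing \<open>(\<alpha>, 0)\<close> for every \<open>\<alpha>\<close> that includes a certain finite part of \<open>P\<^sub>n\<close> are dense,
  but a finite selection leaves out all points with \<open>\<theta>(\<alpha>, 0) = 0\<close> for the union \<open>\<alpha>\<close> of the finite
  parts involved. For $q^+$ take \<open>Q\<^sub>n \<subseteq> P\<^sub>n\<close> with \<open>n + 1\<close> elements and let the \<open>n\<close>-th piece come from
  $\varphi_0, \dots, \varphi_n$, each enlarged by \<open>{\<alpha>. \<alpha> \<inter> Q\<^sub>n = {i}} \<times> {0}\<close> for some \<open>i \<in> Q\<^sub>n\<close>: finitely many \<open>\<alpha>\<close> cannot
  block all \<open>i\<close>, but a selector, choosing \<open>i\<^sub>n\<close> for each \<open>n\<close>, is separated from $\psi_0$ by
  \<open>\<alpha> = {i\<^sub>n | n}\<close>.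

  A set is nowhere dense in $\mathbb{X}(J)$ iff it is so in $\mathbb{X}(D)$ for some countable
  \<open>D \<subseteq> J\<close>, an arithmetical condition on an enumeration of \<open>D\<close>; hence \<open>star\<close> preserves analyticity.\<close>

section \<open>Suslin sets\<close>

definition clopen :: "('a::topological_space \<Rightarrow> bool) \<Rightarrow> bool" where
  "clopen P \<longleftrightarrow> open {x. P x} \<and> closed {x. P x}"

lemma clopen_const: "clopen (\<lambda>_. b)"
  by (cases b) (auto simp: clopen_def)

lemma clopen_not: "clopen P \<Longrightarrow> clopen (\<lambda>x. \<not> P x)"
  by (auto simp: clopen_def open_Collect_neg closed_Collect_neg)

lemma clopen_conj: "clopen P \<Longrightarrow> clopen Q \<Longrightarrow> clopen (\<lambda>x. P x \<and> Q x)"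
  by (auto simp: clopen_def open_Collect_conj closed_Collect_conj)

lemma clopen_disj: "clopen P \<Longrightarrow> clopen Q \<Longrightarrow> clopen (\<lambda>x. P x \<or> Q x)"
  by (auto simp: clopen_def open_Collect_disj closed_Collect_disj)

lemma clopen_eq_bool:
  assumes "clopen P" shows "clopen (\<lambda>x. P x = b)"
  using assms clopen_not[OF assms] by (cases b) simp_all

lemma clopen_ball_finite:
  assumes "finite S" "\<And>i. i \<in> S \<Longrightarrow> clopen (P i)"
  shows "clopen (\<lambda>x. \<forall>i\<in>S. P i x)"
  using assms by (induction S rule: finite_induct) (auto simp: clopen_const intro!: clopen_conj)

lemma clopen_bex_finite:
  assumes "finite S" "\<And>i. i \<in> S \<Longrightarrow> clopen (P i)"
  shows "clopen (\<lambda>x. \<exists>i\<in>S. P i x)"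
  using assms by (induction S rule: finite_induct) (auto simp: clopen_const intro!: clopen_disj)

lemma clopen_comp:
  assumes "continuous_on UNIV f" "clopen P"
  shows "clopen (\<lambda>x. P (f x))"
  using assms open_vimage[of "{x. P x}" f] closed_vimage[of "{x. P x}" f]
  by (simp add: clopen_def vimage_def)

lemma clopen_discrete: "clopen (P :: 'a::discrete_topology \<Rightarrow> bool)"
  by (simp add: clopen_def open_discrete closed_def)

lemma clopen_apply:
  fixes P :: "'b::discrete_topology \<Rightarrow> bool"
  assumes "continuous_on UNIV f"
  shows "clopen (\<lambda>x. P (f x (i::'i)))"
  using clopen_comp[OF continuous_on_product_then_coordinatewise[OF assms] clopen_discrete] .

text \<open>Analyticity as projection of a closed set along the Baire space: closure under
  quantifiers then amounts to recoding the witness \<open>y\<close>. The description by continuous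
  images is recovered in \<open>suslin_imp_baire_image\<close>.\<close>

definition suslin :: "'a::topological_space set \<Rightarrow> bool" where
  "suslin A \<longleftrightarrow> (\<exists>C :: ('a \<times> (nat \<Rightarrow> nat)) set. closed C \<and> A = fst ` C)"

lemma suslinI:
  assumes "closed {(x, y). R x (y :: nat \<Rightarrow> nat)}" "\<And>x. P x \<longleftrightarrow> (\<exists>y. R x y)"
  shows "suslin {x. P x}"
  unfolding suslin_def using assms by (intro exI[of _ "{(x, y). R x y}"]) force

lemma suslinE:
  assumes "suslin {x. P x}"
  obtains R where "closed {(x, y). R x (y :: nat \<Rightarrow> nat)}" "\<And>x. P x \<longleftrightarrow> (\<exists>y. R x y)"
proof -
  obtain C where C: "closed (C :: ('a \<times> (nat \<Rightarrow> nat)) set)" "{x. P x} = fst ` C"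
    using assms by (auto simp: suslin_def)
  show ?thesis
  proof (rule that[of "\<lambda>x y. (x, y) \<in> C"])
    show "P x \<longleftrightarrow> (\<exists>y. (x, y) \<in> C)" for x
      using C(2) by (auto simp: set_eq_iff image_iff Bex_def)
  qed (simp add: C(1))
qed

lemma closed_Collect_comp:
  assumes "closed {(x, y). R x y}" "continuous_on UNIV f" "continuous_on UNIV g"
  shows "closed {z. R (f z) (g z)}"
  using closed_vimage[OF assms(1) continuous_on_Pair[OF assms(2,3)]] by (simp add: vimage_def)

lemma continuous_on_reindex:
  assumes "continuous_on UNIV g"
  shows "continuous_on UNIV (\<lambda>z i. (g z) (h i))"
  by (rule continuous_on_coordinatewise_then_product)
     (rule continuous_on_product_then_coordinatewise[OF assms])

lemmas continuous_on_id_reindex = continuous_on_reindex[OF continuous_on_id]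
lemmas continuous_on_snd_reindex = continuous_on_reindex[OF continuous_on_snd[OF continuous_on_id]]

lemma suslin_closed:
  assumes "closed {x. P x}" shows "suslin {x. P x}"
proof (rule suslinI[of "\<lambda>x y. P x"])
  show "closed {(x, y :: nat \<Rightarrow> nat). P x}"
    using closed_vimage[OF assms continuous_on_fst[OF continuous_on_id]]
    by (simp add: vimage_def split_def)
qed simp

lemma suslin_clopen: "clopen P \<Longrightarrow> suslin {x. P x}"
  by (simp add: clopen_def suslin_closed)

lemma suslin_comp:
  assumes "suslin {x. P x}" "continuous_on UNIV f"
  shows "suslin {x. P (f x)}"
proof -
  obtain R where R: "closed {(x, y). R x (y :: nat \<Rightarrow> nat)}" "\<And>x. P x \<longleftrightarrow> (\<exists>y. R x y)"
    using suslinE[OF assms(1)] by blast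
  have "closed {z. R (f (fst z)) (snd z :: nat \<Rightarrow> nat)}"
    by (rule closed_Collect_comp[OF R(1)])
       (intro continuous_on_compose2[OF assms(2)] continuous_on_fst continuous_on_snd
          continuous_on_id subset_UNIV)+
  then show ?thesis
    by (intro suslinI[of "\<lambda>x. R (f x)"]) (simp_all add: split_def R(2))
qed

text \<open>Countably many witnesses are packed into one sequence, the \<open>n\<close>-th being
  read off along \<open>prod_encode (n, i)\<close>; this decoding is continuous.\<close>

lemma suslin_all_nat:
  assumes "\<And>n::nat. suslin {x. P n x}"
  shows "suslin {x. \<forall>n. P n x}"
proof -
  have "\<forall>n. \<exists>R. closed {(x, y). R x (y :: nat \<Rightarrow> nat)} \<and> (\<forall>x. P n x \<longleftrightarrow> (\<exists>y. R x y))"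
    using suslinE[OF assms] by metis
  then obtain R where R: "\<And>n. closed {(x, y). R n x (y :: nat \<Rightarrow> nat)}"
    "\<And>n x. P n x \<longleftrightarrow> (\<exists>y. R n x y)" by metis
  show ?thesis
  proof (rule suslinI[of "\<lambda>x y. \<forall>n. R n x (\<lambda>i. y (prod_encode (n, i)))"])
    have "closed {z. R n (fst z) (\<lambda>i. snd z (prod_encode (n, i)))}" for n
      by (rule closed_Collect_comp[OF R(1)]) (intro continuous_on_Pair continuous_on_snd_reindex continuous_on_fst continuous_on_id)+
    then show "closed {(x, y). \<forall>n. R n x (\<lambda>i. y (prod_encode (n, i)))}"
      by (simp add: split_def closed_Collect_all)
    show "(\<forall>n. P n x) \<longleftrightarrow> (\<exists>y. \<forall>n. R n x (\<lambda>i. y (prod_encode (n, i))))" for x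
    proof
      assume "\<forall>n. P n x"
      then have "\<forall>n. \<exists>y. R n x y" using R(2) by blast
      then obtain y where y: "\<And>n. R n x (y n)" by metis
      show "\<exists>y. \<forall>n. R n x (\<lambda>i. y (prod_encode (n, i)))"
        by (rule exI[of _ "\<lambda>k. case prod_decode k of (n, i) \<Rightarrow> y n i"]) (simp add: y)
    qed (use R(2) in blast)
  qed
qed

lemma suslin_all:
  assumes "\<And>c::'c::countable. suslin {x. P c x}"
  shows "suslin {x. \<forall>c. P c x}"
proof -
  have "suslin {x. \<forall>n. P (from_nat n) x}"
    by (rule suslin_all_nat) (rule assms)
  moreover have "(\<forall>n. P (from_nat n) x) \<longleftrightarrow> (\<forall>c. P c x)" for x
    by (metis from_nat_to_nat)
  ultimately show ?thesis by simp
qed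

text \<open>The entry \<open>y 0\<close> names the index and the tail of \<open>y\<close> is the
  witness for it. The relation is phrased as a universal statement over \<open>n\<close> so that its
  closedness is that of an intersection.\<close>

lemma suslin_ex_nat:
  assumes "\<And>n::nat. suslin {x. P n x}"
  shows "suslin {x. \<exists>n. P n x}"
proof -
  have "\<forall>n. \<exists>R. closed {(x, y). R x (y :: nat \<Rightarrow> nat)} \<and> (\<forall>x. P n x \<longleftrightarrow> (\<exists>y. R x y))"
    using suslinE[OF assms] by metis
  then obtain R where R: "\<And>n. closed {(x, y). R n x (y :: nat \<Rightarrow> nat)}"
    "\<And>n x. P n x \<longleftrightarrow> (\<exists>y. R n x y)" by metis
  show ?thesis
  proof (rule suslinI[of "\<lambda>x y. \<forall>n. y 0 \<noteq> n \<or> R n x (\<lambda>i. y (Suc i))"])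
    have "closed {z. R n (fst z) (\<lambda>i. snd z (Suc i))}" for n
      by (rule closed_Collect_comp[OF R(1)]) (intro continuous_on_Pair continuous_on_snd_reindex continuous_on_fst continuous_on_id)+
    moreover have "closed {z :: 'a \<times> (nat \<Rightarrow> nat). snd z 0 \<noteq> n}" for n
      using clopen_apply[of "snd :: 'a \<times> (nat \<Rightarrow> nat) \<Rightarrow> _" "\<lambda>k. k \<noteq> n" 0]
      by (simp add: clopen_def continuous_on_snd continuous_on_id)
    ultimately show "closed {(x, y). \<forall>n. y 0 \<noteq> n \<or> R n x (\<lambda>i. y (Suc i))}"
      unfolding split_def by (intro closed_Collect_all closed_Collect_disj)
    show "(\<exists>n. P n x) \<longleftrightarrow> (\<exists>y. \<forall>n. y 0 \<noteq> n \<or> R n x (\<lambda>i. y (Suc i)))" for x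
    proof
      assume "\<exists>n. P n x"
      then obtain n y where y: "R n x y" using R(2) by metis
      show "\<exists>y. \<forall>n. y 0 \<noteq> n \<or> R n x (\<lambda>i. y (Suc i))"
        by (rule exI[of _ "case_nat n y"]) (simp add: y)
    qed (use R(2) in blast)
  qed
qed

lemma suslin_ex:
  assumes "\<And>c::'c::countable. suslin {x. P c x}"
  shows "suslin {x. \<exists>c. P c x}"
proof -
  have "suslin {x. \<exists>n. P (from_nat n) x}"
    by (rule suslin_ex_nat) (rule assms)
  moreover have "(\<exists>n. P (from_nat n) x) \<longleftrightarrow> (\<exists>c. P c x)" for x
    by (metis from_nat_to_nat)
  ultimately show ?thesis by simp
qed

lemma suslin_conj:
  assumes "suslin {x. P x}" "suslin {x. Q x}"
  shows "suslin {x. P x \<and> Q x}"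
proof -
  have "suslin {x. if b then P x else Q x}" for b
    using assms by (cases b) simp_all
  from suslin_all[of "\<lambda>b x. if b then P x else Q x", OF this] show ?thesis
    by (simp add: all_bool_eq conj_commute)
qed

lemma suslin_disj:
  assumes "suslin {x. P x}" "suslin {x. Q x}"
  shows "suslin {x. P x \<or> Q x}"
proof -
  have "suslin {x. if b then P x else Q x}" for b
    using assms by (cases b) simp_all
  from suslin_ex[of "\<lambda>b x. if b then P x else Q x", OF this] show ?thesis
    by (simp add: ex_bool_eq disj_commute)
qed

text \<open>The quantified sequence and its witness are interleaved on even and odd
  positions.\<close>

lemma suslin_ex_baire:
  assumes "suslin {(x, y). P x (y :: nat \<Rightarrow> nat)}"
  shows "suslin {x. \<exists>y. P x y}"
proof -
  have "suslin {z. P (fst z) (snd z)}"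
    using assms by (simp add: split_def)
  then obtain R where R: "closed {(z, y). R z (y :: nat \<Rightarrow> nat)}"
    "\<And>z. P (fst z) (snd z) \<longleftrightarrow> (\<exists>y. R z y)"
    by (rule suslinE) blast
  show ?thesis
  proof (rule suslinI[of "\<lambda>x y. R (x, \<lambda>i. y (2 * i)) (\<lambda>i. y (2 * i + 1))"])
    have "closed {z. R (fst z, \<lambda>i. snd z (2 * i)) (\<lambda>i. snd z (2 * i + 1))}"
      by (rule closed_Collect_comp[OF R(1)]) (intro continuous_on_Pair continuous_on_snd_reindex continuous_on_fst continuous_on_id)+
    then show "closed {(x, y). R (x, \<lambda>i. y (2 * i)) (\<lambda>i. y (2 * i + 1))}"
      by (simp add: split_def)
    show "(\<exists>y. P x y) \<longleftrightarrow> (\<exists>y. R (x, \<lambda>i. y (2 * i)) (\<lambda>i. y (2 * i + 1)))" for x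
    proof
      assume "\<exists>y. P x y"
      then obtain y z where y: "R (x, y) z" using R(2) by (metis fst_conv snd_conv)
      show "\<exists>y. R (x, \<lambda>i. y (2 * i)) (\<lambda>i. y (2 * i + 1))"
        by (rule exI[of _ "\<lambda>i. if even i then y (i div 2) else z (i div 2)"]) (simp add: y)
    qed (use R(2) in \<open>metis fst_conv snd_conv\<close>)
  qed
qed

text \<open>Recording which entries of \<open>y\<close> are nonzero maps the Baire space
  continuously onto the sequences of Cantor points.\<close>

lemma suslin_ex_cantor_seq:
  assumes "suslin {(x, a). P x (a :: nat \<Rightarrow> nat \<Rightarrow> bool)}"
  shows "suslin {x. \<exists>a. P x a}"
proof -
  let ?h = "\<lambda>(y :: nat \<Rightarrow> nat) j i. y (prod_encode (j, i)) \<noteq> 0"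
  have c: "continuous_on UNIV ?h"
    by (intro continuous_on_coordinatewise_then_product)
       (rule continuous_on_compose2[of UNIV "\<lambda>n. n \<noteq> 0"]; simp)
  have "suslin {z. P (fst z) (snd z)}"
    using assms by (simp add: split_def)
  from suslin_comp[OF this continuous_on_Pair[OF continuous_on_fst[OF continuous_on_id]
      continuous_on_compose2[OF c continuous_on_snd[OF continuous_on_id] subset_UNIV]]]
  have "suslin {(x, y). P x (?h y)}"
    by (simp add: split_def)
  then have "suslin {x. \<exists>y. P x (?h y)}"
    by (rule suslin_ex_baire)
  moreover have "(\<exists>y. P x (?h y)) \<longleftrightarrow> (\<exists>a. P x a)" for x
  proof
    assume "\<exists>a. P x a"
    then obtain a where a: "P x a" by blast
    show "\<exists>y. P x (?h y)"
      by (rule exI[of _ "\<lambda>k. case prod_decode k of (j, i) \<Rightarrow> of_bool (a j i)"]) (simp add: a)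
  qed blast
  ultimately show ?thesis by simp
qed

text \<open>Stage \<open>n\<close> replaces the current point \<open>s y n\<close> of
  \<open>C\<close> by one in \<open>C\<close> that agrees with it below \<open>n\<close> and has
  entry \<open>n\<close> equal to \<open>y n\<close>, if there is one. Entries freeze, so the limit
  exists and lies in \<open>C\<close>; for \<open>y\<close> in \<open>C\<close> the search always
  succeeds, so \<open>y\<close> is fixed; and \<open>s y n\<close> depends on \<open>n\<close>
  entries of \<open>y\<close> only, whence continuity.\<close>

lemma baire_retract:
  fixes C :: "(nat \<Rightarrow> nat) set"
  assumes "closed C" "C \<noteq> {}"
  obtains r :: "(nat \<Rightarrow> nat) \<Rightarrow> nat \<Rightarrow> nat" where "continuous_on UNIV r" "range r = C"
proof -
  obtain c0 where c0: "c0 \<in> C" using assms by blast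
  define good where "good y n c d \<longleftrightarrow> d \<in> C \<and> (\<forall>i<n. d i = c i) \<and> d n = y n"
    for y c d :: "nat \<Rightarrow> nat" and n
  define t where "t y n c = (if Ex (good y n c) then Eps (good y n c) else c)" for y c n
  define s where "s y = rec_nat c0 (t y)" for y
  have s0: "s y 0 = c0" for y by (simp add: s_def)
  have sS: "s y (Suc n) = (if Ex (good y n (s y n)) then Eps (good y n (s y n)) else s y n)" for y n
  proof -
    have "s y (Suc n) = t y n (s y n)" by (simp add: s_def)
    then show ?thesis by (simp only: t_def)
  qed
  have good_s: "good y n (s y n) (s y (Suc n))" if "Ex (good y n (s y n))" for y n
    using someI_ex[OF that] that by (simp add: sS)
  have inC: "s y n \<in> C" for y n
  proof (induction n)
    case (Suc n) then show ?case using good_s[of y n] sS[of y n] by (auto simp: good_def)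
  qed (simp add: s0 c0)
  have step: "s y (Suc n) i = s y n i" if "i < n" for y n i
    using good_s[of y n] sS[of y n] that by (auto simp: good_def)
  have stable: "s y m i = s y (Suc i) i" if "Suc i \<le> m" for y m i
    using that by (induction m rule: dec_induct) (auto simp: step)
  \<comment> \<open>Entry \<open>n\<close> may still change in passing to stage \<open>n + 1\<close>
    and is final from there on.\<close>
  define r where "r y n = s y (Suc n) n" for y n
  have rC: "r y \<in> C" for y
  proof -
    have "(\<lambda>m. s y m i) \<longlonglongrightarrow> r y i" for i
    proof (rule tendsto_eventually)
      show "\<forall>\<^sub>F m in sequentially. s y m i = r y i"
        unfolding eventually_sequentially r_def using stable by blast
    qed
    then have "limitin (product_topology (\<lambda>_. euclidean) UNIV) (s y) (r y) sequentially"
      by (simp add: limitin_componentwise)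
    then have "(\<lambda>m. s y m) \<longlonglongrightarrow> r y"
      by (simp only: euclidean_product_topology limitin_canonical_iff)
    then show ?thesis
      using assms(1) inC closed_sequentially by blast
  qed
  have fixC: "r y = y" if y: "y \<in> C" for y
  proof -
    have "\<forall>i<n. s y n i = y i" for n
    proof (induction n)
      case (Suc n)
      then have "good y n (s y n) y" using y by (simp add: good_def)
      then have "good y n (s y n) (s y (Suc n))" using good_s by blast
      then show ?case using Suc by (auto simp: good_def less_Suc_eq)
    qed simp
    then show ?thesis by (auto simp: r_def)
  qed
  have dep: "s y n = s y' n" if "\<forall>i<n. y i = y' i" for y y' n
    using that
  proof (induction n)
    case (Suc n)
    then have "s y n = s y' n" by simp
    moreover have "good y n = good y' n" using Suc.prems by (auto simp: good_def fun_eq_iff)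
    ultimately show ?case by (simp only: sS)
  qed (simp add: s0)
  have "open ((\<lambda>y. r y n) -` B)" for n B
  proof (subst open_subopen, intro ballI)
    fix y assume y: "y \<in> (\<lambda>y. r y n) -` B"
    define T where "T = {z. \<forall>i\<in>{..<Suc n}. z i = y i}"
    have "clopen (\<lambda>z :: nat \<Rightarrow> nat. \<forall>i\<in>{..<Suc n}. z i = y i)"
      by (rule clopen_ball_finite, simp) (rule clopen_apply[OF continuous_on_id])
    then have "open T" by (simp only: clopen_def T_def)
    moreover have "y \<in> T" by (simp add: T_def)
    moreover have "T \<subseteq> (\<lambda>y. r y n) -` B"
    proof
      fix z assume "z \<in> T"
      then have "\<forall>i<Suc n. z i = y i" by (simp only: T_def Ball_def lessThan_iff mem_Collect_eq)
      then have "s z (Suc n) = s y (Suc n)" by (rule dep)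
      then have "r z n = r y n" by (simp only: r_def)
      then show "z \<in> (\<lambda>y. r y n) -` B" using y by simp
    qed
    ultimately show "\<exists>T. open T \<and> y \<in> T \<and> T \<subseteq> (\<lambda>y. r y n) -` B"
      by blast
  qed
  then have "continuous_on UNIV (\<lambda>y. r y n)" for n
    by (simp add: continuous_on_open_vimage)
  then have "continuous_on UNIV r" by (rule continuous_on_coordinatewise_then_product)
  moreover have "range r = C"
  proof
    show "range r \<subseteq> C" by (rule image_subsetI) (rule rC)
    show "C \<subseteq> range r"
    proof
      fix y assume "y \<in> C"
      show "y \<in> range r" by (rule image_eqI[where f = r and x = y, OF fixC[OF \<open>y \<in> C\<close>, symmetric] UNIV_I])
    qed
  qed
  ultimately show thesis by (rule that)
qed

text \<open>Even positions decode to a Cantor point and odd ones to a witness, so \<open>A\<close>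
  is the image under \<open>h\<close> of a closed set \<open>?D\<close> in the Baire space, onto
  which the whole space retracts.\<close>

lemma suslin_imp_baire_image:
  fixes A :: "cantor set"
  assumes "suslin A" "A \<noteq> {}"
  obtains f :: "(nat \<Rightarrow> nat) \<Rightarrow> cantor" where "continuous_on UNIV f" "range f = A"
proof -
  obtain C where C: "closed (C :: (cantor \<times> (nat \<Rightarrow> nat)) set)" "A = fst ` C"
    using assms(1) unfolding suslin_def by blast
  define h where "h y i = (y (2 * i) \<noteq> 0)" for y :: "nat \<Rightarrow> nat" and i
  define t where "t y i = y (2 * i + 1)" for y :: "nat \<Rightarrow> nat" and i
  have ch: "continuous_on UNIV h"
    unfolding h_def by (intro continuous_on_coordinatewise_then_product)
       (rule continuous_on_compose2[of UNIV "\<lambda>n. n \<noteq> 0"]; simp)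
  have ct: "continuous_on UNIV t"
    unfolding t_def by (rule continuous_on_id_reindex)
  let ?D = "{y. (h y, t y) \<in> C}"
  have D: "closed ?D"
    using closed_vimage[OF C(1) continuous_on_Pair[OF ch ct]] by (simp only: vimage_def)
  have D': "\<exists>y. h y = a \<and> t y = b" for a b
  proof -
    let ?y = "\<lambda>i. if even i then of_bool (a (i div 2)) else b (i div 2)"
    have "h ?y = a" "t ?y = b" by (simp_all add: fun_eq_iff h_def t_def)
    then show ?thesis by blast
  qed
  have hD: "h ` ?D = A"
  proof (intro equalityI subsetI)
    fix a assume "a \<in> A"
    then obtain b where "(a, b) \<in> C" using C(2) by auto
    then show "a \<in> h ` ?D" using D'[of a b] by blast
  next
    fix a assume "a \<in> h ` ?D"
    then obtain y where "a = h y" "(h y, t y) \<in> C" by blast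
    then show "a \<in> A" unfolding C(2) by (metis fst_conv imageI)
  qed
  then have "?D \<noteq> {}" using assms(2) by blast
  then obtain r :: "(nat \<Rightarrow> nat) \<Rightarrow> nat \<Rightarrow> nat"
    where r: "continuous_on UNIV r" "range r = ?D"
    by (rule baire_retract[OF D])
  show thesis
  proof (rule that[of "h \<circ> r"])
    show "continuous_on UNIV (h \<circ> r)"
      using r(1) continuous_on_subset[OF ch subset_UNIV] by (rule continuous_on_compose)
    show "range (h \<circ> r) = A" by (simp only: image_comp[symmetric] r(2) hD)
  qed
qed

section \<open>Cylinders and the topologies \<open>\<rho>\<close>\<close>

text \<open>Each triple prescribes one value. Contradictory \<open>P\<close> are allowed and have an
  empty cylinder, hence the recurring hypothesis \<open>cyl P \<noteq> {}\<close>.\<close>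

definition cyl :: "(cantor \<times> nat \<times> bool) set \<Rightarrow> point set" where
  "cyl P = {\<theta>. \<forall>(\<alpha>, m, b)\<in>P. \<theta> (\<alpha>, m) = b}"

definition cond :: "cantor set \<Rightarrow> (cantor \<times> nat \<times> bool) set \<Rightarrow> bool" where
  "cond I P \<longleftrightarrow> finite P \<and> fst ` P \<subseteq> I"

lemma cyl_empty [simp]: "cyl {} = UNIV"
  by (simp add: cyl_def)

lemma cyl_insert: "cyl (insert (\<alpha>, m, b) P) = {\<theta>. \<theta> (\<alpha>, m) = b} \<inter> cyl P"
  by (auto simp: cyl_def)

lemma cyl_Un: "cyl (P \<union> Q) = cyl P \<inter> cyl Q"
  unfolding cyl_def by blast

lemma cyl_mono: "P \<subseteq> Q \<Longrightarrow> cyl Q \<subseteq> cyl P"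
  by (auto simp: cyl_def)

lemma cond_empty [simp]: "cond I {}"
  by (simp add: cond_def)

lemma cond_insert [simp]: "cond I (insert (\<alpha>, m, b) P) \<longleftrightarrow> \<alpha> \<in> I \<and> cond I P"
  by (auto simp: cond_def)

lemma cond_Un [simp]: "cond I (P \<union> Q) \<longleftrightarrow> cond I P \<and> cond I Q"
  by (auto simp: cond_def)

lemma cond_mono: "cond I P \<Longrightarrow> I \<subseteq> J \<Longrightarrow> cond J P"
  by (auto simp: cond_def)

lemma topspace_rho: "I \<noteq> {} \<Longrightarrow> topspace (rho I) = UNIV"
  unfolding rho_def topology_generated_by_topspace by auto

lemma openin_rho_cyl:
  assumes "I \<noteq> {}" "cond I P"
  shows "openin (rho I) (cyl P)"
proof -
  have "finite P" "fst ` P \<subseteq> I" using assms(2) by (auto simp: cond_def)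
  then show ?thesis
  proof (induction P rule: finite_induct)
    case empty
    show ?case using openin_topspace[of "rho I"] by (simp add: topspace_rho[OF assms(1)])
  next
    case (insert p P)
    obtain \<alpha> m b where p: "p = (\<alpha>, m, b)" by (cases p)
    have "openin (rho I) {\<theta>. \<theta> (\<alpha>, m) = b}"
      unfolding rho_def
    proof (rule topology_generated_by_Basis)
      show "{\<theta>. \<theta> (\<alpha>, m) = b} \<in> {{\<theta>. \<theta> (\<alpha>, p)} |\<alpha> p. \<alpha> \<in> I} \<union> {{\<theta>. \<not> \<theta> (\<alpha>, p)} |\<alpha> p. \<alpha> \<in> I}"
        using insert.prems by (cases b) (auto simp: p)
    qed
    then show ?case using insert by (simp add: p cyl_insert openin_Int)
  qed
qed

lemma openin_rhoD:
  assumes "openin (rho I) U" "\<theta> \<in> U"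
  shows "\<exists>P. cond I P \<and> \<theta> \<in> cyl P \<and> cyl P \<subseteq> U"
proof -
  from assms(1) have "generate_topology_on
     ({{\<theta>. \<theta> (\<alpha>, p)} |\<alpha> p. \<alpha> \<in> I} \<union> {{\<theta>. \<not> \<theta> (\<alpha>, p)} |\<alpha> p. \<alpha> \<in> I}) U"
    unfolding rho_def by (rule openin_topology_generated_by)
  then show ?thesis using assms(2)
  proof (induction rule: generate_topology_on.induct)
    case (Int a b)
    then obtain P Q where "cond I P" "\<theta> \<in> cyl P" "cyl P \<subseteq> a" "cond I Q" "\<theta> \<in> cyl Q" "cyl Q \<subseteq> b"
      by blast
    then show ?case by (intro exI[of _ "P \<union> Q"]) (auto simp: cyl_Un)
  next
    case (UN K)
    then obtain k where "k \<in> K" "\<theta> \<in> k" by blast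
    with UN.IH show ?case by blast
  next
    case (Basis s)
    then obtain \<alpha> p where "\<alpha> \<in> I" "s = {\<theta>. \<theta> (\<alpha>, p)} \<or> s = {\<theta>. \<not> \<theta> (\<alpha>, p)}" by blast
    then show ?case using Basis(2)
      by (intro exI[of _ "{(\<alpha>, p, \<theta> (\<alpha>, p))}"]) (auto simp: cyl_insert)
  qed auto
qed

lemma openin_sub_rho:
  assumes "I \<noteq> {}"
  shows "openin (subtopology (rho I) S) U \<longleftrightarrow>
    U \<subseteq> S \<and> (\<forall>\<theta>\<in>U. \<exists>P. cond I P \<and> \<theta> \<in> cyl P \<and> cyl P \<inter> S \<subseteq> U)"
proof
  assume "openin (subtopology (rho I) S) U"
  then obtain T where "openin (rho I) T" "U = T \<inter> S" by (auto simp: openin_subtopology)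
  moreover have "\<exists>P. cond I P \<and> \<theta> \<in> cyl P \<and> cyl P \<inter> S \<subseteq> U" if "\<theta> \<in> U" for \<theta>
    using openin_rhoD[of I T \<theta>] calculation that by blast
  ultimately show "U \<subseteq> S \<and> (\<forall>\<theta>\<in>U. \<exists>P. cond I P \<and> \<theta> \<in> cyl P \<and> cyl P \<inter> S \<subseteq> U)"
    by blast
next
  assume U: "U \<subseteq> S \<and> (\<forall>\<theta>\<in>U. \<exists>P. cond I P \<and> \<theta> \<in> cyl P \<and> cyl P \<inter> S \<subseteq> U)"
  let ?T = "\<Union>{cyl P |P. cond I P \<and> cyl P \<inter> S \<subseteq> U}"
  have "openin (rho I) ?T" using openin_rho_cyl[OF assms] by (intro openin_Union) auto
  moreover have "U = ?T \<inter> S" using U by blast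
  ultimately show "openin (subtopology (rho I) S) U" by (auto simp: openin_subtopology)
qed

lemma topspace_sub_rho: "I \<noteq> {} \<Longrightarrow> topspace (subtopology (rho I) S) = S"
  by (simp add: topspace_rho)

lemma openin_sub_cyl: "I \<noteq> {} \<Longrightarrow> cond I P \<Longrightarrow> openin (subtopology (rho I) S) (cyl P \<inter> S)"
  by (auto simp: openin_sub_rho)

text \<open>A point outside violates some triple, and prescribing its own value there gives a
  neighbourhood off \<open>cyl P\<close>. Basic sets are thus clopen, which yields
  regularity.\<close>

lemma closedin_sub_cyl:
  assumes "I \<noteq> {}" "cond I P"
  shows "closedin (subtopology (rho I) S) (cyl P \<inter> S)"
proof -
  have "\<exists>Q. cond I Q \<and> \<theta> \<in> cyl Q \<and> cyl Q \<inter> S \<subseteq> S - cyl P \<inter> S" if \<theta>: "\<theta> \<in> S - cyl P \<inter> S" for \<theta>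
  proof -
    obtain \<alpha> m b where "(\<alpha>, m, b) \<in> P" "\<theta> (\<alpha>, m) \<noteq> b"
      using \<theta> unfolding cyl_def by blast
    then have *: "(\<alpha>, m, \<not> \<theta> (\<alpha>, m)) \<in> P" by (cases b) simp_all
    then have "\<alpha> \<in> I" using assms(2) by (force simp: cond_def)
    then show ?thesis using *
      by (intro exI[of _ "{(\<alpha>, m, \<theta> (\<alpha>, m))}"]) (force simp: cyl_def)
  qed
  then show ?thesis
    unfolding closedin_def topspace_sub_rho[OF assms(1)] openin_sub_rho[OF assms(1)] by blast
qed

lemma in_closure_of_sub_rho:
  assumes "I \<noteq> {}"
  shows "\<theta> \<in> subtopology (rho I) S closure_of A \<longleftrightarrow>
    \<theta> \<in> S \<and> (\<forall>P. cond I P \<and> \<theta> \<in> cyl P \<longrightarrow> cyl P \<inter> S \<inter> A \<noteq> {})"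
proof
  assume *: "\<theta> \<in> subtopology (rho I) S closure_of A"
  then have "\<theta> \<in> S" by (simp add: in_closure_of)
  moreover have "cyl P \<inter> S \<inter> A \<noteq> {}" if P: "cond I P" "\<theta> \<in> cyl P" for P
  proof -
    have "openin (subtopology (rho I) S) (cyl P \<inter> S)" "\<theta> \<in> cyl P \<inter> S"
      using openin_sub_cyl[OF assms P(1)] P(2) \<open>\<theta> \<in> S\<close> by auto
    then show ?thesis using * unfolding in_closure_of by blast
  qed
  ultimately show "\<theta> \<in> S \<and> (\<forall>P. cond I P \<and> \<theta> \<in> cyl P \<longrightarrow> cyl P \<inter> S \<inter> A \<noteq> {})" by blast
next
  assume *: "\<theta> \<in> S \<and> (\<forall>P. cond I P \<and> \<theta> \<in> cyl P \<longrightarrow> cyl P \<inter> S \<inter> A \<noteq> {})"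
  have "\<exists>\<eta>. \<eta> \<in> A \<and> \<eta> \<in> T" if "\<theta> \<in> T" "openin (subtopology (rho I) S) T" for T
    using that * openin_sub_rho[OF assms, of S T] by fast
  then show "\<theta> \<in> subtopology (rho I) S closure_of A"
    using * by (simp add: in_closure_of topspace_rho[OF assms])
qed

text \<open>Phrased as in forcing: basic sets shrink by adding triples,
  \<open>P \<subseteq> Q\<close>, so that refinements can be iterated and glued.\<close>

lemma nowhere_dense_in_sub_rho:
  assumes "I \<noteq> {}"
  shows "nowhere_dense_in (subtopology (rho I) S) A \<longleftrightarrow> A \<subseteq> S \<and>
    (\<forall>P. cond I P \<and> cyl P \<inter> S \<noteq> {} \<longrightarrow>
      (\<exists>Q. cond I Q \<and> P \<subseteq> Q \<and> cyl Q \<inter> S \<noteq> {} \<and> cyl Q \<inter> A = {}))"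
    (is "?L \<longleftrightarrow> A \<subseteq> S \<and> ?R")
proof (cases "A \<subseteq> S")
  case AS: True
  let ?X = "subtopology (rho I) S"
  have L: "?L \<longleftrightarrow> ?X interior_of (?X closure_of A) = {}"
    using AS by (simp add: nowhere_dense_in_def topspace_rho[OF assms])
  have "?X interior_of (?X closure_of A) = {} \<longleftrightarrow> ?R"
  proof
    assume int: "?X interior_of (?X closure_of A) = {}"
    show ?R
    proof (intro allI impI, elim conjE)
      fix P assume P: "cond I P" "cyl P \<inter> S \<noteq> {}"
      have "\<not> cyl P \<inter> S \<subseteq> ?X closure_of A"
      proof
        assume "cyl P \<inter> S \<subseteq> ?X closure_of A"
        then have "cyl P \<inter> S \<subseteq> ?X interior_of (?X closure_of A)"
          using openin_sub_cyl[OF assms P(1)] by (rule interior_of_maximal)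
        then show False using int P(2) by blast
      qed
      then obtain \<theta> P' where "\<theta> \<in> cyl P \<inter> S" "cond I P'" "\<theta> \<in> cyl P'" "cyl P' \<inter> S \<inter> A = {}"
        unfolding in_closure_of_sub_rho[OF assms] subset_iff by blast
      then show "\<exists>Q. cond I Q \<and> P \<subseteq> Q \<and> cyl Q \<inter> S \<noteq> {} \<and> cyl Q \<inter> A = {}"
        using P(1) AS by (intro exI[of _ "P \<union> P'"]) (auto simp: cyl_Un)
    qed
  next
    assume R: ?R
    show "?X interior_of (?X closure_of A) = {}"
    proof (rule ccontr)
      assume "?X interior_of (?X closure_of A) \<noteq> {}"
      then obtain \<theta> U where U: "openin ?X U" "\<theta> \<in> U" "U \<subseteq> ?X closure_of A"
        by (auto simp: interior_of_def)
      then obtain P where P: "cond I P" "\<theta> \<in> cyl P" "cyl P \<inter> S \<subseteq> U" "\<theta> \<in> S"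
        unfolding openin_sub_rho[OF assms] by blast
      then obtain Q where Q: "cond I Q" "P \<subseteq> Q" "cyl Q \<inter> S \<noteq> {}" "cyl Q \<inter> A = {}"
        using R by blast
      then obtain \<eta> where \<eta>: "\<eta> \<in> cyl Q" "\<eta> \<in> S" by blast
      then have "\<eta> \<in> ?X closure_of A" using cyl_mono[OF Q(2)] P(3) U(3) by blast
      then show False using Q(1,4) \<eta> unfolding in_closure_of_sub_rho[OF assms] by blast
    qed
  qed
  then show ?thesis using L AS by simp
qed (simp add: nowhere_dense_in_def topspace_rho[OF assms])

lemma dense_in_sub_rho:
  assumes "I \<noteq> {}"
  shows "dense_in (subtopology (rho I) S) D \<longleftrightarrow>
    D \<subseteq> S \<and> (\<forall>P. cond I P \<and> cyl P \<inter> S \<noteq> {} \<longrightarrow> cyl P \<inter> D \<noteq> {})"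
proof (cases "D \<subseteq> S")
  case True
  have "dense_in (subtopology (rho I) S) D \<longleftrightarrow> S \<subseteq> subtopology (rho I) S closure_of D"
    using True closure_of_subset_topspace[of "subtopology (rho I) S" D]
    by (auto simp: dense_in_def topspace_rho[OF assms])
  also have "\<dots> \<longleftrightarrow> (\<forall>P. cond I P \<and> cyl P \<inter> S \<noteq> {} \<longrightarrow> cyl P \<inter> D \<noteq> {})"
    unfolding subset_iff in_closure_of_sub_rho[OF assms] using True by blast
  finally show ?thesis using True by simp
qed (simp add: dense_in_def topspace_rho[OF assms])

lemma regular_space_sub_rho:
  assumes "I \<noteq> {}"
  shows "regular_space (subtopology (rho I) S)"
  unfolding regular_space_def
proof (intro allI impI, elim conjE)
  fix C \<theta> assume C: "closedin (subtopology (rho I) S) C" "\<theta> \<in> topspace (subtopology (rho I) S) - C"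
  then have "openin (subtopology (rho I) S) (S - C)" "\<theta> \<in> S - C"
    by (auto simp: closedin_def topspace_rho[OF assms])
  then obtain P where P: "cond I P" "\<theta> \<in> cyl P" "cyl P \<inter> S \<subseteq> S - C"
    unfolding openin_sub_rho[OF assms] by blast
  have "openin (subtopology (rho I) S) (S - cyl P \<inter> S)"
    using closedin_sub_cyl[OF assms P(1), of S] by (auto simp: closedin_def topspace_rho[OF assms])
  moreover have "C \<subseteq> S" using closedin_subset[OF C(1)] by (simp add: topspace_rho[OF assms])
  ultimately show "\<exists>U V. openin (subtopology (rho I) S) U \<and> openin (subtopology (rho I) S) V
      \<and> \<theta> \<in> U \<and> C \<subseteq> V \<and> disjnt U V"
    using P \<open>\<theta> \<in> S - C\<close> openin_sub_cyl[OF assms P(1), of S]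
    by (intro exI[of _ "cyl P \<inter> S"] exI[of _ "S - cyl P \<inter> S"]) (auto simp: disjnt_def)
qed

section \<open>Finite unions of basic sets\<close>

lemma cone_of_clopen:
  assumes "\<And>\<alpha> \<beta>. (\<forall>i<N. \<alpha> i = \<beta> i) \<Longrightarrow> \<alpha> \<in> C \<longleftrightarrow> \<beta> \<in> C"
  obtains L where "finite L" "C = \<Union>(cone ` L)"
proof (rule that)
  let ?L = "{s :: bool list. length s = N \<and> (\<exists>\<alpha>\<in>cone s. \<alpha> \<in> C)}"
  have "finite {s :: bool list. set s \<subseteq> UNIV \<and> length s = N}"
    by (rule finite_lists_length_eq) simp
  then show "finite ?L" by (rule rev_finite_subset) auto
  show "C = \<Union>(cone ` ?L)"
  proof (intro equalityI subsetI)
    fix \<alpha> assume "\<alpha> \<in> C"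
    then have "map \<alpha> [0..<N] \<in> ?L" "\<alpha> \<in> cone (map \<alpha> [0..<N])"
      by (auto simp: cone_def intro!: exI[of _ \<alpha>] bexI[of _ \<alpha>])
    then show "\<alpha> \<in> \<Union>(cone ` ?L)" by blast
  next
    fix \<alpha> assume "\<alpha> \<in> \<Union>(cone ` ?L)"
    then obtain s \<beta> where "length s = N" "\<beta> \<in> cone s" "\<beta> \<in> C" "\<alpha> \<in> cone s" by blast
    then show "\<alpha> \<in> C" using assms[of \<alpha> \<beta>] by (auto simp: cone_def)
  qed
qed

lemma XX_Un:
  assumes "x \<in> XX" "y \<in> XX"
  shows "(\<lambda>z. x z \<or> y z) \<in> XX"
proof -
  obtain B B' where B: "x = (\<lambda>z. z \<in> \<Union>B)" "finite B" "B \<subseteq> {cone s \<times> {n} |s n. True}"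
     "y = (\<lambda>z. z \<in> \<Union>B')" "finite B'" "B' \<subseteq> {cone s \<times> {n} |s n. True}"
    using assms unfolding XX_def by blast
  have "(\<lambda>z. x z \<or> y z) = (\<lambda>z. z \<in> \<Union>(B \<union> B'))" using B(1,4) by auto
  then show ?thesis unfolding XX_def using B by blast
qed

lemma XX_clopen_slice:
  assumes "\<And>\<alpha> \<beta>. (\<forall>i<N. \<alpha> i = \<beta> i) \<Longrightarrow> \<alpha> \<in> C \<longleftrightarrow> \<beta> \<in> C"
  shows "(\<lambda>(\<alpha>, m). \<alpha> \<in> C \<and> m = n) \<in> XX"
proof -
  obtain L where L: "finite L" "C = \<Union>(cone ` L)" by (rule cone_of_clopen[OF assms])
  let ?B = "(\<lambda>s. cone s \<times> {n}) ` L"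
  have "(\<lambda>(\<alpha>, m). \<alpha> \<in> C \<and> m = n) = (\<lambda>z. z \<in> \<Union>?B)" using L(2) by auto
  moreover have "finite ?B" "?B \<subseteq> {cone s \<times> {n} |s n. True}" using L(1) by auto
  ultimately show ?thesis unfolding XX_def by blast
qed

lemma XX_add_slice:
  assumes "x \<in> XX" "\<And>\<alpha> \<beta>. (\<forall>i<N. \<alpha> i = \<beta> i) \<Longrightarrow> \<alpha> \<in> C \<longleftrightarrow> \<beta> \<in> C"
  shows "(\<lambda>(\<alpha>, m). x (\<alpha>, m) \<or> \<alpha> \<in> C \<and> m = n) \<in> XX"
  using XX_Un[OF assms(1) XX_clopen_slice[of N C n, OF assms(2)]]
  by (simp add: split_def)

lemma XX_finite_support:
  assumes "x \<in> XX"
  obtains M where "\<And>\<alpha> m. M \<le> m \<Longrightarrow> \<not> x (\<alpha>, m)"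
proof -
  obtain B where B: "x = (\<lambda>z. z \<in> \<Union>B)" "finite B" "B \<subseteq> {cone s \<times> {n} |s n. True}"
    using assms unfolding XX_def by blast
  have "\<exists>M. \<forall>(\<alpha>, m)\<in>\<Union>B. m < M"
    using B(2,3)
  proof (induction B rule: finite_induct)
    case (insert b B)
    then obtain M s n where M: "\<forall>(\<alpha>, m)\<in>\<Union>B. m < M" "b = cone s \<times> {n}" by auto
    then show ?case by (intro exI[of _ "max M (Suc n)"]) fastforce
  qed simp
  then obtain M where "\<forall>(\<alpha>, m)\<in>\<Union>B. m < M" by blast
  then show thesis by (intro that[of M]) (use B(1) in force)
qed

lemma clopen_XX:
  assumes "x \<in> XX"
  shows "clopen (\<lambda>\<alpha>. x (\<alpha>, m))"
proof -
  obtain B where B: "x = (\<lambda>z. z \<in> \<Union>B)" "finite B" "B \<subseteq> {cone s \<times> {n} |s n. True}"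
    using assms unfolding XX_def by blast
  have "clopen (\<lambda>\<alpha>. \<exists>b\<in>B. (\<alpha>, m) \<in> b)"
  proof (rule clopen_bex_finite[OF B(2)])
    fix b assume "b \<in> B"
    then obtain s n where b: "b = cone s \<times> {n}" using B(3) by blast
    have "clopen (\<lambda>\<alpha> :: cantor. (\<forall>i\<in>{..<length s}. \<alpha> i = s ! i) \<and> m = n)"
      by (intro clopen_conj clopen_ball_finite clopen_const clopen_apply continuous_on_id) simp
    then show "clopen (\<lambda>\<alpha>. (\<alpha>, m) \<in> b)"
      by (simp add: b cone_def lessThan_def)
  qed
  then show ?thesis by (simp add: B(1))
qed

lemma finite_separated:
  fixes A :: "cantor set"
  assumes "finite A"
  obtains N where "\<And>\<alpha> \<beta>. \<alpha> \<in> A \<Longrightarrow> \<beta> \<in> A \<Longrightarrow> (\<forall>i<N. \<alpha> i = \<beta> i) \<Longrightarrow> \<alpha> = \<beta>"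
proof -
  \<comment> \<open>Equal pairs enter with an arbitrary value of \<open>LEAST\<close>, which can
    only enlarge the bound \<open>N\<close>.\<close>
  let ?d = "\<lambda>p :: cantor \<times> cantor. LEAST i. fst p i \<noteq> snd p i"
  have "finite (?d ` (A \<times> A))" using assms by simp
  then obtain N where N: "\<forall>n\<in>?d ` (A \<times> A). n < N"
    using finite_nat_set_iff_bounded by blast
  show thesis
  proof (rule that[of N])
    fix \<alpha> \<beta> assume *: "\<alpha> \<in> A" "\<beta> \<in> A" "\<forall>i<N. \<alpha> i = \<beta> i"
    show "\<alpha> = \<beta>"
    proof (rule ccontr)
      assume "\<alpha> \<noteq> \<beta>"
      then have "\<exists>i. \<alpha> i \<noteq> \<beta> i" by auto
      then have "\<alpha> (?d (\<alpha>, \<beta>)) \<noteq> \<beta> (?d (\<alpha>, \<beta>))"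
        unfolding fst_conv snd_conv by (rule LeastI_ex)
      moreover have "?d (\<alpha>, \<beta>) < N" using N * by blast
      ultimately show False using * by blast
    qed
  qed
qed

text \<open>Cones long enough to separate the finitely many first coordinates in \<open>D\<close> do
  not interfere with each other. This is the source of the density of \<open>XX\<close>.\<close>

lemma XX_realizes:
  assumes "finite D"
  obtains x where "x \<in> XX" "\<And>z. z \<in> D \<Longrightarrow> x z = \<theta> z"
proof -
  obtain N where N: "\<And>\<alpha> \<beta>. \<alpha> \<in> fst ` D \<Longrightarrow> \<beta> \<in> fst ` D \<Longrightarrow> (\<forall>i<N. \<alpha> i = \<beta> i) \<Longrightarrow> \<alpha> = \<beta>"
    using finite_separated[of "fst ` D"] assms by blast
  let ?B = "(\<lambda>(\<alpha>, m). cone (map \<alpha> [0..<N]) \<times> {m}) ` {z \<in> D. \<theta> z}"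
  show thesis
  proof (rule that[of "\<lambda>z. z \<in> \<Union>?B"])
    have "finite ?B" "?B \<subseteq> {cone s \<times> {n} |s n. True}" using assms by auto
    then show "(\<lambda>z. z \<in> \<Union>?B) \<in> XX" unfolding XX_def by blast
    fix z assume z: "z \<in> D"
    obtain \<beta> m where zz: "z = (\<beta>, m)" by (cases z)
    show "(z \<in> \<Union>?B) = \<theta> z"
    proof
      assume "z \<in> \<Union>?B"
      then obtain \<alpha> where \<alpha>: "(\<alpha>, m) \<in> D" "\<theta> (\<alpha>, m)" "\<beta> \<in> cone (map \<alpha> [0..<N])" by (auto simp: zz)
      have "\<alpha> = \<beta>" using N[of \<alpha> \<beta>] \<alpha> z by (force simp: zz cone_def)
      then show "\<theta> z" using \<alpha> zz by simp
    next
      assume "\<theta> z"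
      then have "z \<in> {z \<in> D. \<theta> z}" using z by blast
      then have "cone (map \<beta> [0..<N]) \<times> {m} \<in> ?B"
        by (rule image_eqI[rotated]) (simp add: zz)
      moreover have "z \<in> cone (map \<beta> [0..<N]) \<times> {m}" by (simp add: zz cone_def)
      ultimately show "z \<in> \<Union>?B" by blast
    qed
  qed
qed

lemma cyl_Int_XX:
  assumes "finite P" "cyl P \<noteq> {}"
  shows "cyl P \<inter> XX \<noteq> {}"
proof -
  obtain \<theta> where \<theta>: "\<theta> \<in> cyl P" using assms by blast
  obtain x where x: "x \<in> XX" "\<And>z. z \<in> (\<lambda>(\<alpha>, m, b). (\<alpha>, m)) ` P \<Longrightarrow> x z = \<theta> z"
    using XX_realizes[of "(\<lambda>(\<alpha>, m, b). (\<alpha>, m)) ` P" \<theta>] assms(1) by blast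
  have "x \<in> cyl P" unfolding cyl_def
  proof (clarify)
    fix \<alpha> m b assume p: "(\<alpha>, m, b) \<in> P"
    then have "x (\<alpha>, m) = \<theta> (\<alpha>, m)" by (intro x(2)) force
    then show "x (\<alpha>, m) = b" using \<theta> p by (auto simp: cyl_def)
  qed
  then show ?thesis using x(1) by blast
qed

text \<open>Requirements inside and outside \<open>I\<close> are independent: follow a point of
  \<open>cyl Q\<close> on \<open>I\<close> and a point of \<open>cyl P\<close> off it.\<close>

lemma cyl_glue:
  assumes "cond I Q" "{p \<in> P. fst p \<in> I} \<subseteq> Q" "cyl P \<noteq> {}" "cyl Q \<noteq> {}"
  shows "cyl (P \<union> Q) \<noteq> {}"
proof -
  obtain \<theta> \<eta> where *: "\<theta> \<in> cyl P" "\<eta> \<in> cyl Q" using assms by blast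
  let ?\<zeta> = "\<lambda>z. if fst z \<in> I then \<eta> z else \<theta> z"
  have "?\<zeta> (\<alpha>, m) = b" if "(\<alpha>, m, b) \<in> P \<union> Q" for \<alpha> m b
  proof (cases "\<alpha> \<in> I")
    case True
    then have "(\<alpha>, m, b) \<in> Q" using that assms(2) by auto
    then show ?thesis using True *(2) by (auto simp: cyl_def)
  next
    case False
    then have "(\<alpha>, m, b) \<in> P" using that assms(1) by (force simp: cond_def)
    then show ?thesis using False *(1) by (auto simp: cyl_def)
  qed
  then have "?\<zeta> \<in> cyl (P \<union> Q)" unfolding cyl_def by blast
  then show ?thesis by blast
qed

lemma cond_fresh:
  assumes "cond I P"
  obtains M where "\<And>\<alpha> b. (\<alpha>, M, b) \<notin> P"
proof -
  have "finite ((\<lambda>p. fst (snd p)) ` P)" using assms by (simp add: cond_def)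
  then obtain M where "M \<notin> (\<lambda>p. fst (snd p)) ` P"
    using ex_new_if_finite[OF infinite_UNIV_nat] by blast
  then show thesis by (intro that[of M]) force
qed

lemma cyl_fun_upd:
  assumes "\<theta> \<in> cyl P" "\<And>\<alpha> b. (\<alpha>, M, b) \<notin> P"
  shows "\<theta>((\<beta>, M) := c) \<in> cyl P"
  unfolding cyl_def mem_Collect_eq
proof (intro ballI, clarify)
  fix \<alpha> m b assume "(\<alpha>, m, b) \<in> P"
  moreover from this have "m \<noteq> M" using assms(2) by blast
  ultimately show "(\<theta>((\<beta>, M) := c)) (\<alpha>, m) = b" using assms(1) by (auto simp: cyl_def)
qed

section \<open>The operation \<open>star\<close>\<close>

locale XX_enumeration =
  fixes \<phi> :: "nat \<Rightarrow> point"
  assumes bij: "bij_betw \<phi> UNIV XX"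
begin

lemma phi_XX [simp]: "\<phi> n \<in> XX"
  using bij by (auto simp: bij_betw_def)

lemma XX_phi: "x \<in> XX \<Longrightarrow> \<exists>n. \<phi> n = x"
  using bij by (metis bij_betw_def image_iff)

lemma phi_in_cyl:
  assumes "cond I P" "cyl P \<noteq> {}"
  shows "\<exists>n. \<phi> n \<in> cyl P"
proof -
  obtain x where "x \<in> cyl P" "x \<in> XX" using cyl_Int_XX[of P] assms by (auto simp: cond_def)
  then show ?thesis using XX_phi by blast
qed

lemma phi_finite_support:
  obtains M where "\<And>\<alpha> m. M \<le> m \<Longrightarrow> \<not> \<phi> n (\<alpha>, m)"
  using XX_finite_support[OF phi_XX] by metis

section \<open>Nowhere density in terms of indices, and ideal properties of
  \<open>star\<close>\<close>

lemma mem_star: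
  assumes "I \<noteq> {}"
  shows "F \<in> star \<phi> I \<longleftrightarrow> (\<forall>P. cond I P \<and> cyl P \<noteq> {} \<longrightarrow>
    (\<exists>Q. cond I Q \<and> P \<subseteq> Q \<and> cyl Q \<noteq> {} \<and> (\<forall>n. F n \<longrightarrow> \<phi> n \<notin> cyl Q)))"
proof -
  \<comment> \<open>By density of \<open>XX\<close>, meeting the subspace is mere consistency of the
    condition.\<close>
  have *: "cyl P \<inter> XX \<noteq> {} \<longleftrightarrow> cyl P \<noteq> {}" if "cond I P" for P
    using cyl_Int_XX[of P] that by (auto simp: cond_def)
  have **: "cyl P \<inter> \<phi> ` {n. F n} = {} \<longleftrightarrow> (\<forall>n. F n \<longrightarrow> \<phi> n \<notin> cyl P)" for P
    by blast
  have "\<phi> ` {n. F n} \<subseteq> XX" by auto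
  then show ?thesis
    unfolding star_def X_space_def mem_Collect_eq nowhere_dense_in_sub_rho[OF assms]
    using * ** by (smt (verit, best))
qed

lemma star_refine:
  assumes "I \<noteq> {}" "F \<in> star \<phi> I" "cond I P" "cyl P \<noteq> {}"
  shows "\<exists>Q. cond I Q \<and> P \<subseteq> Q \<and> cyl Q \<noteq> {} \<and> (\<forall>n. F n \<longrightarrow> \<phi> n \<notin> cyl Q)"
  using assms(2-) unfolding mem_star[OF assms(1)] by blast

lemma starI:
  assumes "I \<noteq> {}"
    and "\<And>P. cond I P \<Longrightarrow> cyl P \<noteq> {} \<Longrightarrow>
      \<exists>Q. cond I Q \<and> P \<subseteq> Q \<and> cyl Q \<noteq> {} \<and> (\<forall>n. F n \<longrightarrow> \<phi> n \<notin> cyl Q)"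
  shows "F \<in> star \<phi> I"
  using assms(2) unfolding mem_star[OF assms(1)] by blast

text \<open>Only the part of \<open>P\<close> over \<open>I\<close> has to be refined; by
  \<open>cyl_glue\<close> the rest of \<open>P\<close> stays compatible with the refinement. For
  arbitrary comparable topologies nowhere density need not pass to the finer one.\<close>

lemma star_mono:
  assumes "I \<noteq> {}" "I \<subseteq> J"
  shows "star \<phi> I \<subseteq> star \<phi> J"
proof
  fix F assume F: "F \<in> star \<phi> I"
  show "F \<in> star \<phi> J"
  proof (rule starI)
    show "J \<noteq> {}" using assms by blast
    fix P assume P: "cond J P" "cyl P \<noteq> {}"
    let ?P = "{p \<in> P. fst p \<in> I}"
    have "cond I ?P" using P(1) by (auto simp: cond_def)
    moreover have "cyl ?P \<noteq> {}" using P(2) cyl_mono[of ?P P] by blast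
    ultimately have "\<exists>Q. cond I Q \<and> ?P \<subseteq> Q \<and> cyl Q \<noteq> {} \<and> (\<forall>n. F n \<longrightarrow> \<phi> n \<notin> cyl Q)"
      by (rule star_refine[OF assms(1) F])
    then obtain Q where Q: "cond I Q" "?P \<subseteq> Q" "cyl Q \<noteq> {}" "\<And>n. F n \<Longrightarrow> \<phi> n \<notin> cyl Q"
      by blast
    have "cyl (P \<union> Q) \<noteq> {}" using cyl_glue Q P(2) by blast
    then show "\<exists>Q. cond J Q \<and> P \<subseteq> Q \<and> cyl Q \<noteq> {} \<and> (\<forall>n. F n \<longrightarrow> \<phi> n \<notin> cyl Q)"
      using P(1) cond_mono[OF Q(1) assms(2)] Q(4) by (intro exI[of _ "P \<union> Q"]) (auto simp: cyl_Un)
  qed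
qed

lemma star_subset:
  assumes "I \<noteq> {}" "F \<in> star \<phi> I" "\<And>n. G n \<Longrightarrow> F n"
  shows "G \<in> star \<phi> I"
  using assms(2,3) unfolding mem_star[OF assms(1)] by meson

lemma star_bex_finite:
  assumes "I \<noteq> {}" "finite S" "\<And>i. i \<in> S \<Longrightarrow> F i \<in> star \<phi> I"
  shows "(\<lambda>n. \<exists>i\<in>S. F i n) \<in> star \<phi> I"
  using assms(2,3)
proof (induction S rule: finite_induct)
  case empty
  then show ?case by (intro starI[OF assms(1)]) auto
next
  case (insert i S)
  show ?case
  proof (rule starI[OF assms(1)])
    fix P assume P: "cond I P" "cyl P \<noteq> {}"
    obtain Q where Q: "cond I Q" "P \<subseteq> Q" "cyl Q \<noteq> {}" "\<And>n. F i n \<Longrightarrow> \<phi> n \<notin> cyl Q"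
      using star_refine[OF assms(1) insert.prems[OF insertI1] P] by blast
    have "(\<lambda>n. \<exists>i\<in>S. F i n) \<in> star \<phi> I" using insert by blast
    then obtain R where R: "cond I R" "Q \<subseteq> R" "cyl R \<noteq> {}" "\<And>n. \<exists>i\<in>S. F i n \<Longrightarrow> \<phi> n \<notin> cyl R"
      using star_refine[OF assms(1) _ Q(1,3)] by blast
    show "\<exists>Q. cond I Q \<and> P \<subseteq> Q \<and> cyl Q \<noteq> {} \<and> (\<forall>n. (\<exists>i\<in>insert i S. F i n) \<longrightarrow> \<phi> n \<notin> cyl Q)"
      using Q R cyl_mono[OF R(2)] by (intro exI[of _ R]) blast
  qed
qed

lemma star_Un:
  assumes "I \<noteq> {}" "F \<in> star \<phi> I" "G \<in> star \<phi> I"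
  shows "(\<lambda>n. F n \<or> G n) \<in> star \<phi> I"
proof -
  have "(\<lambda>n. \<exists>H\<in>{F, G}. H n) \<in> star \<phi> I"
    by (rule star_bex_finite[OF assms(1)]) (use assms(2,3) in auto)
  then show ?thesis by simp
qed

lemma star_singleton:
  assumes "I \<noteq> {}"
  shows "(\<lambda>j. j = n) \<in> star \<phi> I"
proof (rule starI[OF assms])
  obtain \<beta> where \<beta>: "\<beta> \<in> I" using assms by blast
  fix P assume P: "cond I P" "cyl P \<noteq> {}"
  obtain M where M: "\<And>\<alpha> b. (\<alpha>, M, b) \<notin> P" using cond_fresh[OF P(1)] by blast
  obtain \<theta> where \<theta>: "\<theta> \<in> cyl P" using P by blast
  \<comment> \<open>At the unmentioned number \<open>M\<close> the value opposite to that of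
    \<open>\<phi> n\<close> can be demanded.\<close>
  let ?Q = "insert (\<beta>, M, \<not> \<phi> n (\<beta>, M)) P"
  have "\<theta>((\<beta>, M) := \<not> \<phi> n (\<beta>, M)) \<in> cyl ?Q"
    unfolding cyl_insert Int_iff mem_Collect_eq fun_upd_same using cyl_fun_upd[OF \<theta> M] by blast
  then have "cyl ?Q \<noteq> {}" by blast
  moreover have "\<forall>j. j = n \<longrightarrow> \<phi> j \<notin> cyl ?Q" by (simp add: cyl_insert)
  moreover have "cond I ?Q" "P \<subseteq> ?Q" using P(1) \<beta> by auto
  ultimately show "\<exists>Q. cond I Q \<and> P \<subseteq> Q \<and> cyl Q \<noteq> {} \<and> (\<forall>j. j = n \<longrightarrow> \<phi> j \<notin> cyl Q)"
    by (intro exI[of _ ?Q] conjI)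
qed

lemma star_finite:
  assumes "I \<noteq> {}" "finite {n. F n}"
  shows "F \<in> star \<phi> I"
  using star_bex_finite[OF assms(1,2), of "\<lambda>n j. j = n"] star_singleton[OF assms(1)] by simp

lemma star_nonempty: "I \<noteq> {} \<Longrightarrow> star \<phi> I \<noteq> {}"
  using star_singleton by blast

lemma iter_star_nonempty: "iter_star \<phi> k \<noteq> {}"
  by (induction k) (simp_all add: star_nonempty)

lemma iter_star_decseq: "iter_star \<phi> (Suc k) \<subseteq> iter_star \<phi> k"
proof (induction k)
  case (Suc k)
  then show ?case using star_mono[OF iter_star_nonempty, of "Suc k"] by simp
qed simp

subsection \<open>Finite selections from a disjoint sequence of open sets\<close>

text \<open>\<open>level \<beta> n\<close> is the index set \<open>P\<^sub>n\<close> above.\<close>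

definition level :: "cantor \<Rightarrow> nat \<Rightarrow> nat \<Rightarrow> bool" where
  "level \<beta> n j \<longleftrightarrow> (\<forall>i<n. \<not> \<phi> j (\<beta>, i)) \<and> \<phi> j (\<beta>, n)"

definition level_cond :: "cantor \<Rightarrow> nat \<Rightarrow> (cantor \<times> nat \<times> bool) set" where
  "level_cond \<beta> n = insert (\<beta>, n, True) ((\<lambda>i. (\<beta>, i, False)) ` {..<n})"

lemma phi_in_level_cond: "\<phi> j \<in> cyl (level_cond \<beta> n) \<longleftrightarrow> level \<beta> n j"
  by (auto simp: level_cond_def level_def cyl_def)

lemma cond_level_cond: "\<beta> \<in> I \<Longrightarrow> cond I (level_cond \<beta> n)"
  by (auto simp: level_cond_def cond_def)

lemma cyl_level_cond_nonempty: "cyl (level_cond \<beta> n) \<noteq> {}"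
proof -
  have "(\<lambda>z. snd z = n) \<in> cyl (level_cond \<beta> n)" by (auto simp: level_cond_def cyl_def)
  then show ?thesis by blast
qed

lemma level_disjoint: "level \<beta> n j \<Longrightarrow> level \<beta> m j \<Longrightarrow> n = m"
  by (metis level_def linorder_neqE_nat)

text \<open>A level indexes a nonempty basic open set, and every consistent refinement of it still
  contains some \<open>\<phi> j\<close>.\<close>

lemma level_notin_star:
  assumes "\<beta> \<in> I"
  shows "level \<beta> n \<notin> star \<phi> I"
proof
  assume *: "level \<beta> n \<in> star \<phi> I"
  have "I \<noteq> {}" using assms by blast
  then obtain Q where Q: "cond I Q" "level_cond \<beta> n \<subseteq> Q" "cyl Q \<noteq> {}"
    "\<And>j. level \<beta> n j \<Longrightarrow> \<phi> j \<notin> cyl Q"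
    using star_refine[OF _ * cond_level_cond[OF assms] cyl_level_cond_nonempty[of \<beta> n]] by blast
  obtain j where "\<phi> j \<in> cyl Q" using phi_in_cyl Q(1,3) by blast
  then show False using Q(4)[of j] phi_in_level_cond[of j \<beta> n] cyl_mono[OF Q(2)] by blast
qed

text \<open>Any condition shrinks into a single level, where the selection leaves only a finite set
  to avoid.\<close>

lemma level_selection_in_star:
  assumes "\<beta> \<in> I" "\<And>n. finite (H n)"
  shows "(\<lambda>j. \<exists>n. level \<beta> n j \<and> j \<in> H n) \<in> star \<phi> I"
proof (rule starI)
  show ne: "I \<noteq> {}" using assms by blast
  fix P assume P: "cond I P" "cyl P \<noteq> {}"
  obtain j where j: "\<phi> j \<in> cyl P" using phi_in_cyl P by blast
  let ?Q = "\<lambda>n. P \<union> level_cond \<beta> n"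
  \<comment> \<open>Making the value True at a fresh \<open>M\<close> guarantees a least position
    with value True, and that position names a compatible level.\<close>
  have "\<exists>n. cyl (?Q n) \<noteq> {}"
  proof -
    obtain M where M: "\<And>\<alpha> b. (\<alpha>, M, b) \<notin> P" using cond_fresh[OF P(1)] by blast
    let ?x = "(\<phi> j)((\<beta>, M) := True)"
    have x: "?x \<in> cyl P" by (rule cyl_fun_upd[OF j M])
    have "?x (\<beta>, M)" by simp
    then have ex: "\<exists>n. ?x (\<beta>, n)" by blast
    let ?n = "LEAST n. ?x (\<beta>, n)"
    have "?x (\<beta>, ?n)" using ex by (rule LeastI_ex)
    moreover have "\<not> ?x (\<beta>, i)" if "i < ?n" for i using that by (rule not_less_Least)
    ultimately have "?x \<in> cyl (level_cond \<beta> ?n)"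
      unfolding cyl_def level_cond_def by blast
    then show ?thesis using x by (metis IntI cyl_Un empty_iff)
  qed
  then obtain n where n: "cyl (?Q n) \<noteq> {}" by blast
  have c: "cond I (?Q n)" using P(1) cond_level_cond[OF assms(1)] by simp
  have H: "(\<lambda>j. j \<in> H n) \<in> star \<phi> I" using star_finite[OF ne] assms(2) by simp
  obtain R where R: "cond I R" "?Q n \<subseteq> R" "cyl R \<noteq> {}" "\<And>j. j \<in> H n \<Longrightarrow> \<phi> j \<notin> cyl R"
    using star_refine[OF ne H c n] by blast
  have "\<phi> j \<notin> cyl R" if "level \<beta> m j" "j \<in> H m" for m j
  proof
    assume "\<phi> j \<in> cyl R"
    then have "\<phi> j \<in> cyl (level_cond \<beta> n)" using cyl_mono[OF R(2)] by (auto simp: cyl_Un)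
    then have "m = n" using that(1) level_disjoint phi_in_level_cond by blast
    then show False using R(4) that(2) \<open>\<phi> j \<in> cyl R\<close> by blast
  qed
  then show "\<exists>Q. cond I Q \<and> P \<subseteq> Q \<and> cyl Q \<noteq> {} \<and>
      (\<forall>j. (\<exists>n. level \<beta> n j \<and> j \<in> H n) \<longrightarrow> \<phi> j \<notin> cyl Q)"
    using R by (intro exI[of _ R]) blast
qed

lemma level_infinite:
  assumes "\<beta> \<in> I"
  shows "infinite {j. level \<beta> n j}"
  using level_notin_star[OF assms, of n] star_finite[of I "level \<beta> n"] assms by blast

section \<open>The space \<open>\<Y>(\<I>)\<close>\<close>

lemma psi_cyl:
  assumes "\<And>\<alpha>. \<alpha> \<in> fst ` P \<Longrightarrow> \<not> \<alpha> n"
  shows "psi \<phi> n \<in> cyl P \<longleftrightarrow> \<phi> n \<in> cyl P"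
  using assms by (force simp: cyl_def psi_def)

text \<open>Since \<open>\<phi> n\<close> has finite support in the second argument, its own row at
  \<open>\<alpha>\<close> cannot be constantly True.\<close>

lemma psi_eq_True: "(\<forall>m. psi \<phi> n (\<alpha>, m)) \<longleftrightarrow> \<alpha> n"
proof -
  obtain M where "\<And>\<alpha> m. M \<le> m \<Longrightarrow> \<not> \<phi> n (\<alpha>, m)" by (rule phi_finite_support[of n]) blast
  then show ?thesis by (auto simp: psi_def)
qed

lemma inj_psi: "inj (psi \<phi>)"
proof (rule injI)
  fix i j assume eq: "psi \<phi> i = psi \<phi> j"
  have "\<forall>m. psi \<phi> i (\<lambda>n. n = i, m)" unfolding psi_eq_True by (rule refl)
  then have "j = i" unfolding eq psi_eq_True .
  then show "i = j" by (rule sym)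
qed

lemma topspace_Y: "I \<noteq> {} \<Longrightarrow> topspace (Y_space \<phi> I) = range (psi \<phi>)"
  by (simp add: Y_space_def topspace_rho)

text \<open>Outside these indices \<phi> and \<psi> agree on the coordinates of \<open>P\<close>, so
  passing between the two spaces costs only a nowhere dense set.\<close>

lemma cond_hull:
  assumes "J \<noteq> {}" "cond (star \<phi> J) P"
  shows "(\<lambda>n. \<exists>\<alpha>\<in>fst ` P. \<alpha> n) \<in> star \<phi> J"
  using star_bex_finite[OF assms(1), of "fst ` P" "\<lambda>\<alpha>. \<alpha>"] assms(2) by (auto simp: cond_def)

text \<open>Removing from a dense set the indices at which some coordinate of \<open>P\<close> or the set \<open>U\<close>
  is hit leaves it somewhere dense; off those indices \<open>\<phi>\<close> and \<open>\<psi>\<close> agree on \<open>P\<close>.\<close>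

lemma psi_meets_cyl:
  assumes "J \<noteq> {}" "star \<phi> J \<subseteq> J" "cond (star \<phi> J) P" "cyl P \<noteq> {}" "U \<in> star \<phi> J"
    and dense: "\<And>Q. cond J Q \<Longrightarrow> cyl Q \<noteq> {} \<Longrightarrow> \<exists>j. E j \<and> \<phi> j \<in> cyl Q"
  shows "\<exists>j. E j \<and> psi \<phi> j \<in> cyl P \<and> \<not> U j"
proof -
  have h: "(\<lambda>n. (\<exists>\<alpha>\<in>fst ` P. \<alpha> n) \<or> U n) \<in> star \<phi> J"
    using star_Un[OF assms(1) cond_hull[OF assms(1,3)] assms(5)] .
  obtain Q where Q: "cond J Q" "P \<subseteq> Q" "cyl Q \<noteq> {}"
    "\<And>n. (\<exists>\<alpha>\<in>fst ` P. \<alpha> n) \<or> U n \<Longrightarrow> \<phi> n \<notin> cyl Q"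
    using star_refine[OF assms(1) h cond_mono[OF assms(3,2)] assms(4)] by blast
  obtain j where j: "E j" "\<phi> j \<in> cyl Q" using dense[OF Q(1,3)] by blast
  then have "\<not> U j" "\<And>\<alpha>. \<alpha> \<in> fst ` P \<Longrightarrow> \<not> \<alpha> j" using Q(4) by blast+
  moreover have "\<phi> j \<in> cyl P" using j cyl_mono[OF Q(2)] by blast
  ultimately show ?thesis using j(1) psi_cyl[of P j] by blast
qed

text \<open>Refine the part of \<open>P\<close> over \<open>star \<phi> J\<close> within the space
  of the \<psi>, glue the result \<open>Q\<close> to the rest of \<open>P\<close>, then refine over
  \<open>J\<close> to avoid the indices where \<phi> and \<psi> may disagree on
  \<open>Q\<close>.\<close>

lemma nowhere_dense_Y:
  assumes "J \<noteq> {}" "star \<phi> J \<subseteq> J" "nowhere_dense_in (Y_space \<phi> (star \<phi> J)) A"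
  shows "(\<lambda>n. psi \<phi> n \<in> A) \<in> star \<phi> J"
proof (rule starI[OF assms(1)])
  let ?I = "star \<phi> J"
  have A: "A \<subseteq> range (psi \<phi>)" "\<And>P. cond ?I P \<Longrightarrow> cyl P \<inter> range (psi \<phi>) \<noteq> {} \<Longrightarrow>
     \<exists>Q. cond ?I Q \<and> P \<subseteq> Q \<and> cyl Q \<inter> range (psi \<phi>) \<noteq> {} \<and> cyl Q \<inter> A = {}"
    using assms(3) unfolding Y_space_def nowhere_dense_in_sub_rho[OF star_nonempty[OF assms(1)]] by blast+
  fix P assume P: "cond J P" "cyl P \<noteq> {}"
  let ?P = "{p \<in> P. fst p \<in> ?I}"
  have P': "cond ?I ?P" using P(1) by (auto simp: cond_def)
  have "cyl ?P \<noteq> {}" using P(2) cyl_mono[of ?P P] by blast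
  then obtain j where "psi \<phi> j \<in> cyl ?P"
    using psi_meets_cyl[OF assms(1,2) P' _ star_singleton[OF assms(1), of 0], of "\<lambda>_. True"] phi_in_cyl
    by blast
  then have "cyl ?P \<inter> range (psi \<phi>) \<noteq> {}" by blast
  then obtain Q where Q: "cond ?I Q" "?P \<subseteq> Q" "cyl Q \<inter> range (psi \<phi>) \<noteq> {}" "cyl Q \<inter> A = {}"
    using A(2)[OF P'] by blast
  have "cyl Q \<noteq> {}" using Q(3) by blast
  then have PQ: "cyl (P \<union> Q) \<noteq> {}" "cond J (P \<union> Q)"
    using cyl_glue[OF Q(1,2) P(2)] P(1) cond_mono[OF Q(1) assms(2)] by auto
  obtain R where R: "cond J R" "P \<union> Q \<subseteq> R" "cyl R \<noteq> {}" "\<And>n. \<exists>\<alpha>\<in>fst ` Q. \<alpha> n \<Longrightarrow> \<phi> n \<notin> cyl R"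
    using star_refine[OF assms(1) cond_hull[OF assms(1) Q(1)] PQ(2,1)] by blast
  have "\<phi> n \<notin> cyl R" if "psi \<phi> n \<in> A" for n
  proof
    assume n: "\<phi> n \<in> cyl R"
    then have "psi \<phi> n \<in> cyl Q \<longleftrightarrow> \<phi> n \<in> cyl Q" using R(4) by (intro psi_cyl) blast
    moreover have "\<phi> n \<in> cyl Q" using n cyl_mono[OF R(2)] by (auto simp: cyl_Un)
    ultimately show False using that Q(4) by blast
  qed
  then show "\<exists>Q. cond J Q \<and> P \<subseteq> Q \<and> cyl Q \<noteq> {} \<and> (\<forall>n. psi \<phi> n \<in> A \<longrightarrow> \<phi> n \<notin> cyl Q)"
    using R by blast
qed

text \<open>By \<open>psi_eq_True\<close> the image is cut out by the clopen requirements of value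
  True at \<open>(F, m)\<close> for all \<open>m\<close>.\<close>

lemma closedin_Y_psi_image:
  assumes "F \<in> I"
  shows "closedin (Y_space \<phi> I) (psi \<phi> ` {n. F n})"
proof -
  have ne: "I \<noteq> {}" using assms by blast
  have "closedin (Y_space \<phi> I) (\<Inter>m. cyl {(F, m, True)} \<inter> range (psi \<phi>))"
    unfolding Y_space_def using closedin_sub_cyl[OF ne] assms by (intro closedin_INT) auto
  moreover have "(\<Inter>m. cyl {(F, m, True)} \<inter> range (psi \<phi>)) = psi \<phi> ` {n. F n}"
    using psi_eq_True by (auto simp: cyl_insert)
  ultimately show ?thesis by simp
qed

section \<open>Nodec and T1; failure of selective separability and of q+\<close>

lemma nodec_Y:
  assumes "J \<noteq> {}" "star \<phi> J \<subseteq> J"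
  shows "nodec_space (Y_space \<phi> (star \<phi> J))"
  unfolding nodec_space_def
proof (intro allI impI)
  fix A assume A: "nowhere_dense_in (Y_space \<phi> (star \<phi> J)) A"
  then have "A \<subseteq> range (psi \<phi>)"
    by (simp add: nowhere_dense_in_def topspace_Y[OF star_nonempty[OF assms(1)]])
  then have "psi \<phi> ` {n. psi \<phi> n \<in> A} = A" by blast
  then show "closedin (Y_space \<phi> (star \<phi> J)) A"
    using closedin_Y_psi_image[OF nowhere_dense_Y[OF assms A]] by simp
qed

lemma t1_Y:
  assumes "J \<noteq> {}"
  shows "t1_space (Y_space \<phi> (star \<phi> J))"
  unfolding t1_space_closedin_singleton
proof
  fix x assume "x \<in> topspace (Y_space \<phi> (star \<phi> J))"
  then obtain n where "x = psi \<phi> n" by (auto simp: topspace_Y[OF star_nonempty[OF assms]])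
  then show "closedin (Y_space \<phi> (star \<phi> J)) {x}"
    using closedin_Y_psi_image[OF star_singleton[OF assms, of n]] by simp
qed

text \<open>By the last two hypotheses no member of \<open>J\<close> contains a whole level, which
  makes the \<open>D n\<close> dense. A finite selection from \<open>D n\<close> is governed by one
  bound \<open>i n\<close>, and the parts of the levels below these bounds do form a member of
  \<open>star \<phi> J\<close>.\<close>

lemma not_selectively_separable_Y:
  assumes "J \<noteq> {}" "star \<phi> J \<subseteq> J" "\<beta> \<in> J"
    and "\<And>n. level \<beta> n \<notin> J" "\<And>G. G \<in> J \<Longrightarrow> (\<And>F. (\<And>j. F j \<Longrightarrow> G j) \<Longrightarrow> F \<in> J)"
  shows "\<not> selectively_separable (Y_space \<phi> (star \<phi> J))"
proof
  let ?I = "star \<phi> J"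
  \<comment> \<open>These clopen sets decrease in \<open>i\<close>, and no member of
    \<open>J\<close> lies in all of them.\<close>
  let ?C = "\<lambda>n i. {\<alpha> :: cantor. \<forall>j<i. level \<beta> n j \<longrightarrow> \<alpha> j}"
  define E where "E n i j \<longleftrightarrow> (\<forall>\<alpha>\<in>?C n i. \<phi> j (\<alpha>, 0))" for n i j
  define D where "D n = psi \<phi> ` {j. \<exists>i. E n i j}" for n
  have ne: "?I \<noteq> {}" using star_nonempty[OF assms(1)] .
  have E_mono: "E n k j" if "E n i j" "i \<le> k" for n i k j
    using that unfolding E_def by auto
  have "dense_in (Y_space \<phi> ?I) (D n)" for n
    unfolding Y_space_def dense_in_sub_rho[OF ne]
  proof (intro conjI allI impI; (elim conjE)?)
    show "D n \<subseteq> range (psi \<phi>)" by (auto simp: D_def)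
    fix P assume P: "cond ?I P" "cyl P \<inter> range (psi \<phi>) \<noteq> {}"
    have "\<exists>j. (\<exists>i. E n i j) \<and> \<phi> j \<in> cyl Q" if Q: "cond J Q" "cyl Q \<noteq> {}" for Q
    proof -
      obtain j0 where j0: "\<phi> j0 \<in> cyl Q" using phi_in_cyl Q by blast
      have "\<exists>i. \<alpha> \<notin> ?C n i" if "\<alpha> \<in> fst ` Q" for \<alpha>
      proof -
        have "\<alpha> \<in> J" using that Q(1) by (auto simp: cond_def)
        then obtain j where "level \<beta> n j" "\<not> \<alpha> j" using assms(4)[of n] assms(5)[of \<alpha>] by blast
        then show ?thesis by (intro exI[of _ "Suc j"]) auto
      qed
      then obtain f where f: "\<And>\<alpha>. \<alpha> \<in> fst ` Q \<Longrightarrow> \<alpha> \<notin> ?C n (f \<alpha>)" by metis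
      have "finite (f ` fst ` Q)" using Q(1) by (simp add: cond_def)
      then obtain i where i: "\<forall>k\<in>f ` fst ` Q. k \<le> i" using finite_nat_set_iff_bounded_le by blast
      have C: "\<alpha> \<notin> ?C n i" if "\<alpha> \<in> fst ` Q" for \<alpha>
        using f[OF that] i that by (auto dest: less_le_trans)
      \<comment> \<open>Adding \<open>?C n i \<times> {0}\<close> alters no value at a coordinate of
        \<open>Q\<close>, since none of them lies in \<open>?C n i\<close>.\<close>
      have "(\<lambda>(\<alpha>, m). \<phi> j0 (\<alpha>, m) \<or> \<alpha> \<in> ?C n i \<and> m = 0) \<in> XX"
        by (rule XX_add_slice[of _ i]) auto
      then obtain j where j: "\<phi> j = (\<lambda>(\<alpha>, m). \<phi> j0 (\<alpha>, m) \<or> \<alpha> \<in> ?C n i \<and> m = 0)"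
        using XX_phi by blast
      have "E n i j" by (auto simp: E_def j)
      moreover have "\<phi> j (\<alpha>, m) = \<phi> j0 (\<alpha>, m)" if "\<alpha> \<in> fst ` Q" for \<alpha> m
        using C[OF that] by (auto simp: j)
      then have "\<phi> j \<in> cyl Q" using j0 unfolding cyl_def by force
      ultimately show ?thesis by blast
    qed
    then obtain j where "\<exists>i. E n i j" "psi \<phi> j \<in> cyl P"
      using psi_meets_cyl[OF assms(1,2) P(1) _ star_singleton[OF assms(1), of 0], of "\<lambda>j. \<exists>i. E n i j"] P(2)
      by blast
    then show "cyl P \<inter> D n \<noteq> {}" by (auto simp: D_def)
  qed
  moreover assume "selectively_separable (Y_space \<phi> ?I)"
  ultimately obtain F where F: "\<And>n. finite (F n)" "\<And>n. F n \<subseteq> D n" "dense_in (Y_space \<phi> ?I) (\<Union>n. F n)"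
    unfolding selectively_separable_def by metis
  have "\<exists>i. \<forall>x\<in>F n. \<exists>j. x = psi \<phi> j \<and> E n i j" for n
  proof -
    have "\<forall>x\<in>F n. \<exists>i j. x = psi \<phi> j \<and> E n i j" using F(2)[of n] unfolding D_def by blast
    then obtain f where f: "\<And>x. x \<in> F n \<Longrightarrow> \<exists>j. x = psi \<phi> j \<and> E n (f x) j" by metis
    have "finite (f ` F n)" using F(1) by simp
    then obtain i where "\<forall>k\<in>f ` F n. k \<le> i" using finite_nat_set_iff_bounded_le by blast
    then show ?thesis using f E_mono by (intro exI[of _ i]) blast
  qed
  then obtain i where i: "\<And>n x. x \<in> F n \<Longrightarrow> \<exists>j. x = psi \<phi> j \<and> E n (i n) j" by metis
  \<comment> \<open>This union of finite parts of levels lies in every \<open>?C n (i n)\<close>, so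
    all selected points have value True at \<open>(\<alpha>, 0)\<close>.\<close>
  define \<alpha> where "\<alpha> = (\<lambda>j. \<exists>n. level \<beta> n j \<and> j \<in> {..<i n})"
  have "\<alpha> \<in> ?I" unfolding \<alpha>_def by (rule level_selection_in_star[OF assms(3)]) simp
  have all: "x (\<alpha>, 0)" if "x \<in> F n" for x n
  proof -
    obtain j where "x = psi \<phi> j" "E n (i n) j" using i \<open>x \<in> F n\<close> by blast
    moreover have "\<alpha> \<in> ?C n (i n)" by (auto simp: \<alpha>_def)
    ultimately show ?thesis by (auto simp: E_def psi_def)
  qed
  have P: "cond ?I {(\<alpha>, 0, False)}" using \<open>\<alpha> \<in> ?I\<close> by simp
  have "(\<lambda>_. False) \<in> cyl {(\<alpha>, 0, False)}" by (simp add: cyl_def)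
  then have "cyl {(\<alpha>, 0, False)} \<noteq> {}" by blast
  then obtain j where "psi \<phi> j \<in> cyl {(\<alpha>, 0, False)}"
    using psi_meets_cyl[OF assms(1,2) P _ star_singleton[OF assms(1), of 0], of "\<lambda>_. True"] phi_in_cyl
    by blast
  then have "cyl {(\<alpha>, 0, False)} \<inter> (\<Union>n. F n) \<noteq> {}"
    using F(3) P unfolding Y_space_def dense_in_sub_rho[OF ne] by blast
  then show False using all by (auto simp: cyl_def)
qed

text \<open>The property fails at \<open>psi \<phi> 0\<close>. For fixed \<open>n\<close> the sets
  \<open>C n i\<close> with \<open>i \<in> Q n\<close> are disjoint, so \<open>n\<close> coordinates
  cannot meet all \<open>n + 1\<close> of them, and the union of the pieces accumulates at that
  point. A selector commits itself to one \<open>i\<close> for each \<open>n\<close>.\<close>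

lemma not_q_plus_Y:
  assumes "J \<noteq> {}" "star \<phi> J \<subseteq> J" "\<phi> 0 = (\<lambda>_. False)"
  shows "\<not> q_plus_space (Y_space \<phi> (star \<phi> J))"
proof
  let ?I = "star \<phi> J"
  let ?Y = "Y_space \<phi> ?I"
  have ne: "?I \<noteq> {}" using star_nonempty[OF assms(1)] .
  obtain \<beta> where \<beta>: "\<beta> \<in> J" using assms(1) by blast
  have "\<exists>B. B \<subseteq> {j. level \<beta> n j} \<and> finite B \<and> card B = Suc n" for n
    using infinite_arbitrarily_large[OF level_infinite[OF \<beta>]] by metis
  then obtain Q where Q: "\<And>n. Q n \<subseteq> {j. level \<beta> n j}" "\<And>n. finite (Q n)" "\<And>n. card (Q n) = Suc n"
    by metis
  have Q_disj: "n = m" if "j \<in> Q n" "j \<in> Q m" for j n m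
    using level_disjoint Q(1) that by blast
  have Q0: "0 \<notin> Q n" for n using Q(1)[of n] assms(3) by (auto simp: level_def)
  define C where "C n i = {\<alpha> :: cantor. \<forall>j\<in>Q n. \<alpha> j \<longleftrightarrow> j = i}" for n i
  define W where "W n = {j. \<exists>m\<le>n. \<exists>i\<in>Q n. \<phi> j = (\<lambda>(\<alpha>, p). \<phi> m (\<alpha>, p) \<or> \<alpha> \<in> C n i \<and> p = 0)}" for n
  \<comment> \<open>The \<open>W n\<close> may overlap; \<open>disjointed\<close> yields a partition
    whose pieces stay inside the images of the \<open>W n\<close>.\<close>
  define F where "F = disjointed (\<lambda>n. psi \<phi> ` W n)"
  have W_finite: "finite (W n)" for n
  proof -
    have "inj \<phi>" using bij by (simp add: bij_betw_def)
    moreover have "\<phi> ` W n \<subseteq> (\<lambda>(m, i) (\<alpha>, p). \<phi> m (\<alpha>, p) \<or> \<alpha> \<in> C n i \<and> p = 0) ` ({..n} \<times> Q n)"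
      by (force simp: W_def)
    then have "finite (\<phi> ` W n)" by (rule finite_subset) (simp add: Q(2))
    ultimately show ?thesis using finite_imageD inj_on_subset by blast
  qed
  have W_dense: "\<exists>j. (\<exists>n. j \<in> W n) \<and> \<phi> j \<in> cyl P" if P: "cond J P" "cyl P \<noteq> {}" for P
  proof -
    obtain m where m: "\<phi> m \<in> cyl P" using phi_in_cyl P by blast
    \<comment> \<open>Large enough for \<open>W n\<close> to use \<open>\<phi> m\<close> and for
      \<open>Q n\<close> to have more elements than \<open>P\<close> has coordinates.\<close>
    define n where "n = max m (card (fst ` P))"
    have fin: "finite (fst ` P)" using P(1) by (simp add: cond_def)
    have "\<exists>i\<in>Q n. \<forall>\<alpha>\<in>fst ` P. \<alpha> \<notin> C n i"
    proof (rule ccontr)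
      assume "\<not> ?thesis"
      then have "\<forall>i\<in>Q n. \<exists>\<alpha>. \<alpha> \<in> fst ` P \<and> \<alpha> \<in> C n i" by blast
      then obtain f where f: "\<forall>i\<in>Q n. f i \<in> fst ` P \<and> f i \<in> C n i"
        by (rule bchoice[THEN exE])
      have "inj_on f (Q n)"
      proof (rule inj_onI)
        fix i j assume ij: "i \<in> Q n" "j \<in> Q n" "f i = f j"
        have "f i \<in> C n i" "f i \<in> C n j" using f ij by auto
        then show "i = j" using ij(1) by (auto simp: C_def)
      qed
      then have "card (Q n) \<le> card (fst ` P)" using f fin by (intro card_inj_on_le[of f]) auto
      then show False by (simp add: Q(3) n_def)
    qed
    then obtain i where i: "i \<in> Q n" "\<And>\<alpha>. \<alpha> \<in> fst ` P \<Longrightarrow> \<alpha> \<notin> C n i" by blast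
    obtain N where N: "\<forall>j\<in>Q n. j < N" using Q(2) finite_nat_set_iff_bounded by blast
    have "(\<lambda>(\<alpha>, p). \<phi> m (\<alpha>, p) \<or> \<alpha> \<in> C n i \<and> p = 0) \<in> XX"
      by (rule XX_add_slice[of _ N]) (use N in \<open>auto simp: C_def\<close>)
    then obtain j where j: "\<phi> j = (\<lambda>(\<alpha>, p). \<phi> m (\<alpha>, p) \<or> \<alpha> \<in> C n i \<and> p = 0)"
      using XX_phi by blast
    have "m \<le> n" by (simp add: n_def)
    then have "j \<in> W n" using j i(1) unfolding W_def by blast
    moreover have "\<phi> j (\<alpha>, p) = \<phi> m (\<alpha>, p)" if "\<alpha> \<in> fst ` P" for \<alpha> p
      using i(2)[OF that] by (auto simp: j)
    then have "\<phi> j \<in> cyl P" using m unfolding cyl_def by force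
    ultimately show ?thesis by blast
  qed
  have F: "\<And>n. finite (F n)" "disjoint_family F" "(\<Union>n. F n) = (\<Union>n. psi \<phi> ` W n)"
    using finite_subset[OF disjointed_subset[of "\<lambda>n. psi \<phi> ` W n"] finite_imageI[OF W_finite]]
    by (auto simp: F_def disjoint_family_disjointed UN_disjointed_eq)
  let ?A = "\<Union>n. psi \<phi> ` W n"
  have cl: "psi \<phi> 0 \<in> ?Y closure_of (?A - {psi \<phi> 0})"
    unfolding Y_space_def in_closure_of_sub_rho[OF ne]
  proof (intro conjI allI impI; (elim conjE)?)
    fix P assume P: "cond ?I P" "psi \<phi> 0 \<in> cyl P"
    \<comment> \<open>Excluding the index 0 keeps the point found away from
      \<open>psi \<phi> 0\<close>.\<close>
    obtain j where j: "\<exists>n. j \<in> W n" "psi \<phi> j \<in> cyl P" "j \<noteq> 0"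
      using psi_meets_cyl[OF assms(1,2) P(1) _ star_singleton[OF assms(1), of 0], of "\<lambda>j. \<exists>n. j \<in> W n"]
        P(2) W_dense by blast
    then have "psi \<phi> j \<noteq> psi \<phi> 0" using inj_psi by (metis injD)
    then show "cyl P \<inter> range (psi \<phi>) \<inter> (?A - {psi \<phi> 0}) \<noteq> {}" using j by blast
  qed simp
  have no: "S \<in> point_ideal ?Y (psi \<phi> 0)" if S: "S \<subseteq> ?A" "\<And>n. card (S \<inter> F n) \<le> 1" for S
  proof -
    have "\<exists>i\<in>Q n. \<forall>x\<in>S \<inter> F n. \<forall>\<alpha>\<in>C n i. x (\<alpha>, 0)" for n
    proof (cases "S \<inter> F n = {}")
      case True
      \<comment> \<open>An empty trace of \<open>S\<close> imposes nothing, so any element of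
        \<open>Q n\<close> serves.\<close>
      have "Q n \<noteq> {}" using Q(3)[of n] by auto
      then show ?thesis using True by blast
    next
      case False
      then obtain x where x: "x \<in> S \<inter> F n" by blast
      have "finite (S \<inter> F n)" using F(1) by blast
      then have *: "y = x" if "y \<in> S \<inter> F n" for y
        using S(2)[of n] x that card_le_Suc0_iff_eq[of "S \<inter> F n"] by auto
      have "x \<in> psi \<phi> ` W n" using x disjointed_subset[of "\<lambda>n. psi \<phi> ` W n" n] by (auto simp: F_def)
      then obtain j m i where "x = psi \<phi> j" "i \<in> Q n"
        "\<phi> j = (\<lambda>(\<alpha>, p). \<phi> m (\<alpha>, p) \<or> \<alpha> \<in> C n i \<and> p = 0)" by (auto simp: W_def)
      then have "i \<in> Q n" "\<forall>\<alpha>\<in>C n i. x (\<alpha>, 0)" by (auto simp: psi_def)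
      then show ?thesis using * by blast
    qed
    then obtain i where i: "\<And>n. i n \<in> Q n" "\<And>n x \<alpha>. x \<in> S \<inter> F n \<Longrightarrow> \<alpha> \<in> C n (i n) \<Longrightarrow> x (\<alpha>, 0)"
      by metis
    \<comment> \<open>One element from each of the disjoint sets \<open>Q n\<close>, so \<alpha>
      meets \<open>Q n\<close> exactly in \<open>i n\<close>.\<close>
    define \<alpha> where "\<alpha> = (\<lambda>j. \<exists>n. level \<beta> n j \<and> j \<in> {i n})"
    have \<alpha>I: "\<alpha> \<in> ?I" unfolding \<alpha>_def by (rule level_selection_in_star[OF \<beta>]) simp
    have \<alpha>: "\<alpha> j \<longleftrightarrow> (\<exists>n. j = i n)" for j using i(1) Q(1) by (auto simp: \<alpha>_def)
    have "\<alpha> \<in> C n (i n)" for n using i(1) Q_disj unfolding C_def by (auto simp: \<alpha>)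
    then have S1: "x (\<alpha>, 0)" if "x \<in> S" for x
      using S(1) F(3) i(2) that by blast
    \<comment> \<open>\<open>\<phi> 0\<close> is empty, so 0 lies in no level and
      \<open>psi \<phi> 0\<close> keeps the value False at \<open>(\<alpha>, 0)\<close>.\<close>
    have "\<not> \<alpha> 0" using Q0 i(1) \<alpha> by metis
    then have "psi \<phi> 0 \<in> cyl {(\<alpha>, 0, False)}" by (simp add: cyl_def psi_def assms(3))
    moreover have "cond ?I {(\<alpha>, 0, False)}" using \<alpha>I by simp
    moreover have "cyl {(\<alpha>, 0, False)} \<inter> S = {}" using S1 by (auto simp: cyl_def)
    ultimately have "psi \<phi> 0 \<notin> ?Y closure_of (S - {psi \<phi> 0})"
      unfolding Y_space_def in_closure_of_sub_rho[OF ne] by blast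
    then show ?thesis using S(1) by (auto simp: point_ideal_def topspace_Y[OF ne])
  qed
  assume "q_plus_space ?Y"
  then have "q_plus (range (psi \<phi>)) (point_ideal ?Y (psi \<phi> 0))"
    by (simp add: q_plus_space_def topspace_Y[OF ne])
  moreover have "?A \<subseteq> range (psi \<phi>)" by blast
  moreover have "?A \<notin> point_ideal ?Y (psi \<phi> 0)" using cl by (simp add: point_ideal_def)
  ultimately have "\<exists>S. S \<subseteq> ?A \<and> S \<notin> point_ideal ?Y (psi \<phi> 0) \<and> (\<forall>n. card (S \<inter> F n) \<le> 1)"
    unfolding q_plus_def using F by blast
  then show False using no by blast
qed

end

section \<open>Analyticity\<close>

text \<open>Lists of indices into \<open>a\<close> code the conditions over its range by a countable
  type independent of \<open>a\<close>, so that quantifiers over conditions become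
  countable.\<close>

definition lcond :: "(nat \<Rightarrow> cantor) \<Rightarrow> (nat \<times> nat \<times> bool) list \<Rightarrow> (cantor \<times> nat \<times> bool) set" where
  "lcond a p = (\<lambda>(j, m, b). (a j, m, b)) ` set p"

lemma lcond_append: "lcond a (p @ q) = lcond a p \<union> lcond a q"
  by (simp add: lcond_def image_Un)

lemma cond_lcond: "(\<And>j. a j \<in> I) \<Longrightarrow> cond I (lcond a p)"
  by (auto simp: lcond_def cond_def)

lemma cond_range_lcond:
  assumes "cond (range a) P"
  obtains p where "P = lcond a p"
proof -
  have "finite P" "fst ` P \<subseteq> range a" using assms by (auto simp: cond_def)
  then have "\<exists>p. P = lcond a p"
  proof (induction P rule: finite_induct)
    case empty
    then show ?case by (intro exI[of _ "[]"]) (simp add: lcond_def)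
  next
    case (insert x P)
    obtain p where p: "P = lcond a p" using insert by auto
    obtain j m b where x: "x = (a j, m, b)" using insert.prems by (cases x) auto
    show ?case by (intro exI[of _ "(j, m, b) # p"]) (simp add: lcond_def p x)
  qed
  then show thesis using that by blast
qed

lemma cond_imp_lcond:
  assumes "I \<noteq> {}" "cond I P"
  obtains a p where "\<And>j. a j \<in> I" "P = lcond a p"
proof -
  obtain \<beta> where \<beta>: "\<beta> \<in> I" using assms by blast
  have fin: "finite (fst ` P)" and sub: "fst ` P \<subseteq> I" using assms(2) by (auto simp: cond_def)
  \<comment> \<open>Adding \<beta> keeps the enumerated set nonempty when \<open>P\<close> is
    empty.\<close>
  let ?a = "from_nat_into (insert \<beta> (fst ` P))"
  have r: "range ?a = insert \<beta> (fst ` P)"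
    by (rule range_from_nat_into) (use fin in \<open>auto intro: countable_finite\<close>)
  then have "cond (range ?a) P" using assms(2) by (auto simp: cond_def)
  then obtain p where "P = lcond ?a p" by (rule cond_range_lcond)
  moreover have "?a j \<in> I" for j
  proof -
    have "insert \<beta> (fst ` P) \<subseteq> I" using sub \<beta> by blast
    moreover have "?a j \<in> range ?a" by (rule rangeI)
    ultimately show ?thesis unfolding r by (rule subsetD)
  qed
  ultimately show thesis by (intro that[of ?a p])
qed

lemma clopen_in_cyl_lcond:
  assumes "\<And>m. clopen (\<lambda>\<alpha>. x (\<alpha>, m))" "continuous_on UNIV f"
  shows "clopen (\<lambda>z. x \<in> cyl (lcond (f z) p))"
proof -
  have "clopen (\<lambda>z. \<forall>q\<in>set p. x (f z (fst q), fst (snd q)) = snd (snd q))"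
  proof (rule clopen_ball_finite)
    fix q :: "nat \<times> nat \<times> bool"
    show "clopen (\<lambda>z. x (f z (fst q), fst (snd q)) = snd (snd q))"
      by (rule clopen_eq_bool, rule clopen_comp[of "\<lambda>z. f z (fst q)" "\<lambda>\<alpha>. x (\<alpha>, fst (snd q))"])
         (rule continuous_on_product_then_coordinatewise[OF assms(2)], rule assms(1))
  qed simp
  moreover have "x \<in> cyl (lcond (f z) p) \<longleftrightarrow>
      (\<forall>q\<in>set p. x (f z (fst q), fst (snd q)) = snd (snd q))" for z
    by (force simp: cyl_def lcond_def)
  ultimately show ?thesis by simp
qed

lemma suslin_all_in:
  assumes "suslin I"
  shows "suslin {z :: 'a::topological_space \<times> (nat \<Rightarrow> cantor). \<forall>j. snd z j \<in> I}"
proof (rule suslin_all)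
  fix j :: nat
  have "continuous_on UNIV (\<lambda>z :: 'a \<times> (nat \<Rightarrow> cantor). snd z j)"
    by (rule continuous_on_product_then_coordinatewise[OF continuous_on_snd[OF continuous_on_id]])
  then show "suslin {z :: 'a \<times> (nat \<Rightarrow> cantor). snd z j \<in> I}"
    using suslin_comp[of "\<lambda>x. x \<in> I"] assms by simp
qed

lemma clopen_fst: "clopen (\<lambda>z :: cantor \<times> (nat \<Rightarrow> cantor). fst z n)"
  by (rule clopen_apply[where P = "\<lambda>b. b", OF continuous_on_fst[OF continuous_on_id]])

context XX_enumeration
begin

text \<open>Closing off under a choice of refinements shows that nowhere density is witnessed by
  countably many coordinates.\<close>

lemma star_countable_witness:
  assumes "I \<noteq> {}" "F \<in> star \<phi> I"
  obtains D where "D \<subseteq> I" "D \<noteq> {}" "countable D" "F \<in> star \<phi> D"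
proof -
  obtain \<beta> where \<beta>: "\<beta> \<in> I" using assms by blast
  have "\<forall>P. \<exists>Q. cond I P \<and> cyl P \<noteq> {} \<longrightarrow>
      cond I Q \<and> P \<subseteq> Q \<and> cyl Q \<noteq> {} \<and> (\<forall>n. F n \<longrightarrow> \<phi> n \<notin> cyl Q)"
    using star_refine[OF assms] by blast
  then obtain R where R: "\<And>P. cond I P \<Longrightarrow> cyl P \<noteq> {} \<Longrightarrow>
      cond I (R P) \<and> P \<subseteq> R P \<and> cyl (R P) \<noteq> {} \<and> (\<forall>n. F n \<longrightarrow> \<phi> n \<notin> cyl (R P))"
    by metis
  \<comment> \<open>Adjoins all coordinates occurring in the chosen refinements of consistent
    conditions over \<open>X\<close>.\<close>
  define N where "N X = X \<union> (\<Union>P\<in>{P. cond X P \<and> cyl P \<noteq> {}}. fst ` R P)" for X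
  define D where "D n = (N ^^ n) {\<beta>}" for n
  have D_Suc: "D (Suc n) = N (D n)" for n by (simp add: D_def)
  have D: "D n \<subseteq> I \<and> countable (D n)" for n
  proof (induction n)
    case 0
    then show ?case using \<beta> by (simp add: D_def)
  next
    case (Suc n)
    have sub: "fst ` R P \<subseteq> I" "finite (R P)" if "cond (D n) P" "cyl P \<noteq> {}" for P
      using R[OF cond_mono[OF that(1)] that(2)] Suc by (auto simp: cond_def)
    have "countable (D n \<times> (UNIV :: (nat \<times> bool) set))" using Suc by simp
    then have "countable {P. finite P \<and> P \<subseteq> D n \<times> (UNIV :: (nat \<times> bool) set)}"
      by (rule countable_Collect_finite_subset)
    then have "countable {P. cond (D n) P \<and> cyl P \<noteq> {}}"
      by (rule countable_subset[rotated]) (force simp: cond_def)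
    then have "countable (N (D n))" unfolding N_def
      using Suc sub(2) by (intro countable_Un countable_UN) (auto intro: countable_finite)
    moreover have "N (D n) \<subseteq> I" unfolding N_def using Suc sub(1) by blast
    ultimately show ?case by (simp add: D_Suc)
  qed
  have D_mono: "D m \<subseteq> D n" if "m \<le> n" for m n
    using that by (induction n rule: dec_induct) (auto simp: D_Suc N_def)
  let ?D = "\<Union>n. D n"
  have "F \<in> star \<phi> ?D"
  proof (rule starI)
    show "?D \<noteq> {}" by (auto intro: exI[of _ 0] simp: D_def)
    fix P assume P: "cond ?D P" "cyl P \<noteq> {}"
    \<comment> \<open>The stages increase, so the coordinates of \<open>P\<close> lie in one stage
      and those of its chosen refinement in the next.\<close>
    have "\<exists>n. A \<subseteq> D n" if "finite A" "A \<subseteq> ?D" for A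
      using that
    proof (induction A rule: finite_induct)
      case (insert x A)
      then obtain m n where mn: "A \<subseteq> D n" "x \<in> D m" by auto
      have "insert x A \<subseteq> D (max m n)"
        using mn D_mono[of n "max m n"] D_mono[of m "max m n"] by auto
      then show ?case by blast
    qed simp
    from this[of "fst ` P"] P(1) obtain n where n: "fst ` P \<subseteq> D n" by (auto simp: cond_def)
    then have c: "cond (D n) P" using P(1) by (auto simp: cond_def)
    then have "cond I P" using cond_mono D by blast
    note R = R[OF this P(2)]
    have "fst ` R P \<subseteq> D (Suc n)" using c P(2) by (auto simp: D_Suc N_def)
    then have "cond ?D (R P)" using R by (auto simp: cond_def)
    then show "\<exists>Q. cond ?D Q \<and> P \<subseteq> Q \<and> cyl Q \<noteq> {} \<and> (\<forall>n. F n \<longrightarrow> \<phi> n \<notin> cyl Q)"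
      using R by blast
  qed
  moreover have "?D \<subseteq> I" "countable ?D" "?D \<noteq> {}" using D by (auto intro: exI[of _ 0] simp: D_def[of 0])
  ultimately show thesis using that by blast
qed

text \<open>All quantifiers on the right are over numbers and lists: some \<open>\<phi> n\<close> in
  the cylinder expresses consistency, and appending \<open>r\<close> expresses refinement. The
  disjunctions match the closure rules for Suslin sets.\<close>

lemma mem_star_range:
  "F \<in> star \<phi> (range a) \<longleftrightarrow> (\<forall>p. (\<forall>n. \<phi> n \<notin> cyl (lcond a p)) \<or>
    (\<exists>r. (\<exists>n. \<phi> n \<in> cyl (lcond a (p @ r))) \<and> (\<forall>n. \<not> F n \<or> \<phi> n \<notin> cyl (lcond a (p @ r)))))"
    (is "_ \<longleftrightarrow> ?R")
proof
  assume F: "F \<in> star \<phi> (range a)"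
  show ?R
  proof
    fix p
    show "(\<forall>n. \<phi> n \<notin> cyl (lcond a p)) \<or>
      (\<exists>r. (\<exists>n. \<phi> n \<in> cyl (lcond a (p @ r))) \<and> (\<forall>n. \<not> F n \<or> \<phi> n \<notin> cyl (lcond a (p @ r))))"
    proof (rule disj_imp[THEN iffD2], rule impI)
      assume "\<not> (\<forall>n. \<phi> n \<notin> cyl (lcond a p))"
      then have ne: "cyl (lcond a p) \<noteq> {}" by blast
      have c: "cond (range a) (lcond a p)" by (rule cond_lcond) simp
      obtain Q where Q: "cond (range a) Q" "lcond a p \<subseteq> Q" "cyl Q \<noteq> {}" "\<forall>n. F n \<longrightarrow> \<phi> n \<notin> cyl Q"
        using star_refine[OF _ F c ne] by blast
      obtain r where r: "Q = lcond a r" using cond_range_lcond[OF Q(1)] .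
      have "Q = lcond a (p @ r)" using Q(2) r by (auto simp: lcond_append)
      then show "\<exists>r. (\<exists>n. \<phi> n \<in> cyl (lcond a (p @ r))) \<and> (\<forall>n. \<not> F n \<or> \<phi> n \<notin> cyl (lcond a (p @ r)))"
        using phi_in_cyl[OF Q(1,3)] Q(4) by (intro exI[of _ r]) simp
    qed
  qed
next
  assume R: ?R
  show "F \<in> star \<phi> (range a)"
  proof (rule starI)
    fix P assume P: "cond (range a) P" "cyl P \<noteq> {}"
    obtain p where p: "P = lcond a p" using cond_range_lcond[OF P(1)] .
    then have "\<not> (\<forall>n. \<phi> n \<notin> cyl (lcond a p))" using phi_in_cyl[OF P] by simp
    then obtain r where r: "\<exists>n. \<phi> n \<in> cyl (lcond a (p @ r))" "\<forall>n. \<not> F n \<or> \<phi> n \<notin> cyl (lcond a (p @ r))"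
      using R by blast
    have "cond (range a) (lcond a (p @ r))" by (rule cond_lcond) simp
    moreover have "P \<subseteq> lcond a (p @ r)" by (simp add: p lcond_append)
    ultimately show "\<exists>Q. cond (range a) Q \<and> P \<subseteq> Q \<and> cyl Q \<noteq> {} \<and> (\<forall>n. F n \<longrightarrow> \<phi> n \<notin> cyl Q)"
      using r by (intro exI[of _ "lcond a (p @ r)"]) blast
  qed simp
qed

text \<open>Countable witnesses give one direction, \<open>star_mono\<close> the other. The one
  uncountable quantifier left is existential, hence a projection.\<close>

lemma mem_star_iff_seq:
  assumes "I \<noteq> {}"
  shows "F \<in> star \<phi> I \<longleftrightarrow> (\<exists>a. (\<forall>j::nat. a j \<in> I) \<and> F \<in> star \<phi> (range a))"
proof
  assume "F \<in> star \<phi> I"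
  then obtain D where D: "D \<subseteq> I" "D \<noteq> {}" "countable D" "F \<in> star \<phi> D"
    by (rule star_countable_witness[OF assms])
  have "from_nat_into D j \<in> I" for j using from_nat_into[OF D(2)] D(1) by (rule subsetD[rotated])
  then show "\<exists>a. (\<forall>j::nat. a j \<in> I) \<and> F \<in> star \<phi> (range a)"
    using D by (intro exI[of _ "from_nat_into D"]) (simp add: range_from_nat_into)
next
  assume "\<exists>a. (\<forall>j::nat. a j \<in> I) \<and> F \<in> star \<phi> (range a)"
  then obtain a :: "nat \<Rightarrow> cantor" where a: "\<And>j. a j \<in> I" "F \<in> star \<phi> (range a)" by blast
  have "star \<phi> (range a) \<subseteq> star \<phi> I" by (rule star_mono) (use a in auto)
  then show "F \<in> star \<phi> I" using a by blast
qed

lemma suslin_star: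
  assumes "I \<noteq> {}" "suslin I"
  shows "suslin (star \<phi> I)"
proof -
  have cl: "clopen (\<lambda>z :: cantor \<times> (nat \<Rightarrow> cantor). \<phi> n \<in> cyl (lcond (snd z) p))" for n p
    by (intro clopen_in_cyl_lcond clopen_XX phi_XX continuous_on_snd continuous_on_id)
  have "suslin {z :: cantor \<times> (nat \<Rightarrow> cantor). fst z \<in> star \<phi> (range (snd z))}"
    unfolding mem_star_range
    by (intro suslin_all suslin_disj suslin_ex suslin_conj suslin_clopen clopen_not clopen_disj cl clopen_fst)
  from suslin_conj[OF suslin_all_in[OF assms(2)] this]
  have "suslin {(F, a). (\<forall>j. a j \<in> I) \<and> F \<in> star \<phi> (range (a :: nat \<Rightarrow> cantor))}"
    by (simp add: split_def)
  then have "suslin {F. \<exists>a. (\<forall>j::nat. a j \<in> I) \<and> F \<in> star \<phi> (range a)}"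
    by (rule suslin_ex_cantor_seq)
  moreover have "star \<phi> I = {F. \<exists>a. (\<forall>j::nat. a j \<in> I) \<and> F \<in> star \<phi> (range a)}"
    by (rule set_eqI, unfold mem_Collect_eq, rule mem_star_iff_seq[OF assms(1)])
  ultimately show ?thesis by (simp only:)
qed

lemma suslin_iter_star: "suslin (iter_star \<phi> k)"
proof (induction k)
  case 0
  show ?case using suslin_clopen[OF clopen_const[of True]] by simp
next
  case (Suc k)
  then show ?case using suslin_star[OF iter_star_nonempty] by simp
qed

section \<open>The topology as an analytic set\<close>

lemma openin_Y_iff:
  assumes "I \<noteq> {}"
  shows "openin (Y_space \<phi> I) (psi \<phi> ` {n. F n}) \<longleftrightarrow>
    (\<forall>n. \<not> F n \<or> (\<exists>a. (\<forall>j. a j \<in> I) \<and>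
      (\<exists>p. psi \<phi> n \<in> cyl (lcond a p) \<and> (\<forall>m. psi \<phi> m \<notin> cyl (lcond a p) \<or> F m))))"
    (is "?L \<longleftrightarrow> ?R")
proof -
  let ?S = "\<lambda>P. cyl P \<inter> range (psi \<phi>) \<subseteq> psi \<phi> ` {n. F n}"
  have S: "?S P \<longleftrightarrow> (\<forall>m. psi \<phi> m \<notin> cyl P \<or> F m)" for P
  proof -
    have "?S P \<longleftrightarrow> (\<forall>m. psi \<phi> m \<in> cyl P \<longrightarrow> psi \<phi> m \<in> psi \<phi> ` {n. F n})" by blast
    then show ?thesis unfolding inj_image_mem_iff[OF inj_psi] mem_Collect_eq by blast
  qed
  have "?L \<longleftrightarrow> (\<forall>n. F n \<longrightarrow> (\<exists>P. cond I P \<and> psi \<phi> n \<in> cyl P \<and> ?S P))"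
    unfolding Y_space_def openin_sub_rho[OF assms] by auto
  also have "\<dots> \<longleftrightarrow> ?R"
  proof -
    have "(\<exists>P. cond I P \<and> psi \<phi> n \<in> cyl P \<and> ?S P) \<longleftrightarrow> (\<exists>a. (\<forall>j. a j \<in> I) \<and>
      (\<exists>p. psi \<phi> n \<in> cyl (lcond a p) \<and> (\<forall>m. psi \<phi> m \<notin> cyl (lcond a p) \<or> F m)))" for n
    proof
      assume "\<exists>P. cond I P \<and> psi \<phi> n \<in> cyl P \<and> ?S P"
      then obtain P where P: "cond I P" "psi \<phi> n \<in> cyl P" "?S P" by blast
      obtain a p where "\<forall>j. a j \<in> I" "P = lcond a p"
        by (rule cond_imp_lcond[OF assms P(1)]) blast
      then show "\<exists>a. (\<forall>j. a j \<in> I) \<and>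
          (\<exists>p. psi \<phi> n \<in> cyl (lcond a p) \<and> (\<forall>m. psi \<phi> m \<notin> cyl (lcond a p) \<or> F m))"
        using P(2,3) unfolding S by blast
    next
      assume "\<exists>a. (\<forall>j. a j \<in> I) \<and>
          (\<exists>p. psi \<phi> n \<in> cyl (lcond a p) \<and> (\<forall>m. psi \<phi> m \<notin> cyl (lcond a p) \<or> F m))"
      then obtain a p where a: "\<And>j. a j \<in> I" "psi \<phi> n \<in> cyl (lcond a p)"
        "\<forall>m. psi \<phi> m \<notin> cyl (lcond a p) \<or> F m" by blast
      show "\<exists>P. cond I P \<and> psi \<phi> n \<in> cyl P \<and> ?S P"
        unfolding S by (intro exI[of _ "lcond a p"] conjI cond_lcond a)
    qed
    then show ?thesis by blast
  qed
  finally show ?thesis .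
qed

lemma clopen_psi: "clopen (\<lambda>\<alpha>. psi \<phi> n (\<alpha>, m))"
proof -
  have "clopen (\<lambda>\<alpha> :: cantor. \<alpha> n \<or> \<phi> n (\<alpha>, m))"
    by (intro clopen_disj clopen_XX phi_XX)
       (rule clopen_apply[where P = "\<lambda>b. b", OF continuous_on_id])
  moreover have "psi \<phi> n (\<alpha>, m) \<longleftrightarrow> \<alpha> n \<or> \<phi> n (\<alpha>, m)" for \<alpha> by (simp add: psi_def)
  ultimately show ?thesis by simp
qed

text \<open>The quantifier over sequences stands inside the one over \<open>n\<close>, which is
  harmless because countable intersections of Suslin sets are Suslin.\<close>

lemma suslin_openin_Y:
  assumes "I \<noteq> {}" "suslin I"
  shows "suslin {F. openin (Y_space \<phi> I) (psi \<phi> ` {n. F n})}"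
proof -
  have cl: "clopen (\<lambda>z :: cantor \<times> (nat \<Rightarrow> cantor). psi \<phi> n \<in> cyl (lcond (snd z) p))" for n p
    by (intro clopen_in_cyl_lcond clopen_psi continuous_on_snd continuous_on_id)
  have "suslin {F. \<exists>a. (\<forall>j. a j \<in> I) \<and>
      (\<exists>p. psi \<phi> n \<in> cyl (lcond a p) \<and> (\<forall>m. psi \<phi> m \<notin> cyl (lcond a p) \<or> F m))}" for n
  proof (rule suslin_ex_cantor_seq)
    have "suslin {z :: cantor \<times> (nat \<Rightarrow> cantor). (\<forall>j. snd z j \<in> I) \<and>
      (\<exists>p. psi \<phi> n \<in> cyl (lcond (snd z) p) \<and> (\<forall>m. psi \<phi> m \<notin> cyl (lcond (snd z) p) \<or> fst z m))}"
      by (intro suslin_conj suslin_all_in[OF assms(2)] suslin_all suslin_ex suslin_clopen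
          clopen_not clopen_disj cl clopen_fst)
    then show "suslin {(F, a). (\<forall>j. a j \<in> I) \<and>
      (\<exists>p. psi \<phi> n \<in> cyl (lcond a p) \<and> (\<forall>m. psi \<phi> m \<notin> cyl (lcond a p) \<or> F m))}"
      by (simp add: split_def)
  qed
  moreover have "suslin {F :: cantor. \<not> F n}" for n
    by (intro suslin_clopen clopen_not) (rule clopen_apply[where P = "\<lambda>b. b", OF continuous_on_id])
  ultimately show ?thesis
    unfolding openin_Y_iff[OF assms(1)] by (intro suslin_all suslin_disj)
qed

lemma analytic_Y:
  assumes "I \<noteq> {}" "suslin I"
  shows "analytic_topology (Y_space \<phi> I)"
proof -
  let ?Y = "Y_space \<phi> I" and ?Z = "range (psi \<phi>)"
  let ?T = "{F. openin ?Y (psi \<phi> ` {n. F n})}"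
  have "(\<lambda>_. False) \<in> ?T" by simp
  then have "?T \<noteq> {}" by blast
  then obtain f :: "(nat \<Rightarrow> nat) \<Rightarrow> cantor" where f: "continuous_on UNIV f" "range f = ?T"
    by (rule suslin_imp_baire_image[OF suslin_openin_Y[OF assms]])
  \<comment> \<open>Transports index sets to characteristic functions on the points, using that
    \<open>psi \<phi>\<close> is injective.\<close>
  define g where "g y = restrict (\<lambda>z. f y (inv (psi \<phi>) z)) ?Z" for y
  have "continuous_map euclidean (discrete_topology UNIV) (\<lambda>y. f y i)" for i
  proof -
    have "open {y. f y i \<in> U}" for U
      using clopen_apply[OF f(1), of "\<lambda>b. b \<in> U" i] by (simp add: clopen_def)
    then show ?thesis by (simp add: continuous_map_def)
  qed
  then have g: "continuous_map euclidean (powerset_space ?Z) g"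
    unfolding powerset_space_def continuous_map_componentwise
    by (auto simp: g_def intro: continuous_map_eq)
  have g_eq: "g y = restrict (\<lambda>z. z \<in> psi \<phi> ` {n. f y n}) ?Z" for y
    unfolding g_def using inj_psi by (intro restrict_ext) (auto simp: inj_image_mem_iff)
  have "range g = {restrict (\<lambda>z. z \<in> U) ?Z |U. openin ?Y U}"
  proof (intro equalityI subsetI)
    fix h assume "h \<in> range g"
    then obtain y where y: "h = restrict (\<lambda>z. z \<in> psi \<phi> ` {n. f y n}) ?Z" using g_eq by blast
    have "f y \<in> ?T" using f(2) by blast
    then show "h \<in> {restrict (\<lambda>z. z \<in> U) ?Z |U. openin ?Y U}" using y by blast
  next
    fix h assume "h \<in> {restrict (\<lambda>z. z \<in> U) ?Z |U. openin ?Y U}"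
    then obtain U where U: "h = restrict (\<lambda>z. z \<in> U) ?Z" "openin ?Y U" by blast
    then have "U \<subseteq> ?Z" using openin_subset[OF U(2)] topspace_Y[OF assms(1)] by simp
    then have eq: "psi \<phi> ` {n. psi \<phi> n \<in> U} = U" by blast
    then have "(\<lambda>n. psi \<phi> n \<in> U) \<in> ?T" using U(2) by simp
    then obtain y where y: "f y = (\<lambda>n. psi \<phi> n \<in> U)" using f(2) by (metis imageE)
    have "h = g y" unfolding g_eq y eq U(1) ..
    then show "h \<in> range g" by blast
  qed
  then show ?thesis
    using g unfolding analytic_topology_def analytic_subset_def topspace_Y[OF assms(1)] by auto
qed

end

theorem theorem3p35:
  fixes \<phi> :: "nat \<Rightarrow> point" and k :: nat
  assumes "bij_betw \<phi> UNIV XX"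
    and "\<phi> 0 = (\<lambda>_. False)"
    and "k > 1"
  shows "nodec_space (Y_space \<phi> (iter_star \<phi> k))
    \<and> regular_space (Y_space \<phi> (iter_star \<phi> k))
    \<and> t1_space (Y_space \<phi> (iter_star \<phi> k))
    \<and> analytic_topology (Y_space \<phi> (iter_star \<phi> k))
    \<and> \<not> selectively_separable (Y_space \<phi> (iter_star \<phi> k))
    \<and> \<not> q_plus_space (Y_space \<phi> (iter_star \<phi> k))"
proof -
  interpret XX_enumeration \<phi> using assms(1) by unfold_locales
  \<comment> \<open>Since \<open>k\<close> exceeds 1, the family \<open>?J\<close> before the last
    step is itself \<open>star \<phi> ?H\<close>; this makes it hereditary and keeps the levels out
    of it.\<close>
  define l where "l = k - 2"
  have k: "k = Suc (Suc l)" using assms(3) by (simp add: l_def)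
  let ?H = "iter_star \<phi> l" and ?J = "iter_star \<phi> (Suc l)"
  have H: "?H \<noteq> {}" and J: "?J \<noteq> {}" by (rule iter_star_nonempty)+
  have IJ: "star \<phi> ?J \<subseteq> ?J" using iter_star_decseq[of "Suc l"] by simp
  have I: "iter_star \<phi> k = star \<phi> ?J" by (simp add: k)
  obtain \<beta> where \<beta>: "\<beta> \<in> ?J" using J by blast
  then have "\<beta> \<in> ?H" using iter_star_decseq by blast
  then have level: "level \<beta> n \<notin> ?J" for n
    using level_notin_star[of \<beta> ?H n] by simp
  have sub: "G \<in> ?J" if "F \<in> ?J" "\<And>j. G j \<Longrightarrow> F j" for F G
    using star_subset[OF H, of F G] that by simp
  have "suslin (star \<phi> ?J)" using suslin_iter_star[of k] by (simp add: I)
  then show ?thesis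
    unfolding I
    using nodec_Y[OF J IJ] t1_Y[OF J] analytic_Y[OF star_nonempty[OF J]]
      not_selectively_separable_Y[OF J IJ \<beta> level sub] not_q_plus_Y[OF J IJ assms(2)]
      regular_space_sub_rho[OF star_nonempty[OF J], of "range (psi \<phi>)"]
    by (simp add: Y_space_def)
qed

end
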